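(* Let $d,m$ be positive integers such that $d$ is divisible by $2$ or by $3$. Then there are infinitely many totally real number fields $F$ with $[F:\mathbb{Q}]=d$ such that every universal quadratic form over $F$ has rank at least $m$.
   Context: For a totally real number field $F$ with ring of integers $\mathcal{O}_F$, an element $\alpha\in F$ is totally positive if $\sigma(\alpha)>0$ for every real embedding $\sigma$ of $F$; $\mathcal{O}_F^+$ denotes the set of totally positive elements of $\mathcal{O}_F$. A quadratic form $Q$ in $r$ variables with coefficients in $\mathcal{O}_F$ is totally positive if for every real embedding $\sigma$ of $F$ the real quadratic form $\sigma(Q)$ is positive definite; its rank is the number $r$ of variables. Such a totally positive form is universal over $F$ if it represents every element of $\mathcal{O}_F^+$, i.e., for every $\alpha\in\mathcal{O}_F^+$ there is $x\in\mathcal{O}_F^r$ with $Q(x)=\alpha$. Quadratic forms are not assumed to be classical (cross terms need not be divisible by $2$). *)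

theory Defs
  imports Complex_Main "HOL-Algebra.Algebraic_Closure_Type"
begin

text \<open>
  Number fields are realised as subfields of the complex numbers; every number field is
  isomorphic to such a subfield.
\<close>

abbreviation complex_ring :: "complex ring"
  where "complex_ring \<equiv> ring_of_type_algebra"

abbreviation real_ring :: "real ring"
  where "real_ring \<equiv> ring_of_type_algebra"

abbreviation field_of :: "complex set \<Rightarrow> complex ring"
  where "field_of F \<equiv> complex_ring\<lparr>carrier := F\<rparr>"

definition number_field :: "complex set \<Rightarrow> bool"
  where "number_field F \<longleftrightarrow> subfield F complex_ring \<and> ring.finite_dimension complex_ring \<rat> F"

definition field_degree :: "complex set \<Rightarrow> nat"
  where "field_degree F = ring.dim complex_ring \<rat> F"

text \<open>
  Embeddings are unconstrained outside \<open>F\<close>; below they are only applied to elements of \<open>F\<close>.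
\<close>

definition complex_embeddings :: "complex set \<Rightarrow> (complex \<Rightarrow> complex) set"
  where "complex_embeddings F = ring_hom (field_of F) complex_ring"

definition real_embeddings :: "complex set \<Rightarrow> (complex \<Rightarrow> real) set"
  where "real_embeddings F = ring_hom (field_of F) real_ring"

definition totally_real :: "complex set \<Rightarrow> bool"
  where "totally_real F \<longleftrightarrow> (\<forall>\<tau>\<in>complex_embeddings F. \<tau> ` F \<subseteq> \<real>)"

definition ring_of_integers :: "complex set \<Rightarrow> complex set"
  where "ring_of_integers F = {x \<in> F. algebraic_int x}"

definition totally_positive_integers :: "complex set \<Rightarrow> complex set"
  where "totally_positive_integers F =
    {\<alpha> \<in> ring_of_integers F. \<forall>\<sigma>\<in>real_embeddings F. \<sigma> \<alpha> > 0}"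

text \<open>
  A quadratic form in \<open>r\<close> variables is given by its coefficients \<open>a i j\<close> with
  \<open>i \<le> j < r\<close>, where \<open>a i j\<close> is the full coefficient of the monomial \<open>x i * x j\<close>,
  so that non-classical forms are included. Other values of \<open>a\<close> are irrelevant.
\<close>

definition qform :: "nat \<Rightarrow> (nat \<Rightarrow> nat \<Rightarrow> 'a::comm_ring_1) \<Rightarrow> (nat \<Rightarrow> 'a) \<Rightarrow> 'a"
  where "qform r a x = (\<Sum>j<r. \<Sum>i\<le>j. a i j * x i * x j)"

definition integral_form :: "complex set \<Rightarrow> nat \<Rightarrow> (nat \<Rightarrow> nat \<Rightarrow> complex) \<Rightarrow> bool"
  where "integral_form F r a \<longleftrightarrow> (\<forall>j<r. \<forall>i\<le>j. a i j \<in> ring_of_integers F)"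

definition positive_definite_form :: "nat \<Rightarrow> (nat \<Rightarrow> nat \<Rightarrow> real) \<Rightarrow> bool"
  where "positive_definite_form r b \<longleftrightarrow>
    (\<forall>x :: nat \<Rightarrow> real. (\<exists>i<r. x i \<noteq> 0) \<longrightarrow> qform r b x > 0)"

definition totally_positive_form :: "complex set \<Rightarrow> nat \<Rightarrow> (nat \<Rightarrow> nat \<Rightarrow> complex) \<Rightarrow> bool"
  where "totally_positive_form F r a \<longleftrightarrow>
    (\<forall>\<sigma>\<in>real_embeddings F. positive_definite_form r (\<lambda>i j. \<sigma> (a i j)))"

definition universal_form :: "complex set \<Rightarrow> nat \<Rightarrow> (nat \<Rightarrow> nat \<Rightarrow> complex) \<Rightarrow> bool"
  where "universal_form F r a \<longleftrightarrow>
    integral_form F r a \<and> totally_positive_form F r a \<and>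
    (\<forall>\<alpha>\<in>totally_positive_integers F.
       \<exists>x. (\<forall>i<r. x i \<in> ring_of_integers F) \<and> qform r a x = \<alpha>)"

end

theory Submission
  imports Defs "Jordan_Normal_Form.Char_Poly"
begin

text \<open>
  Let \<open>F = \<rat>(y)\<close> be totally real of degree \<open>d\<close>, where the minimal polynomial of \<open>y\<close> is
  \<open>x^d - Q x^(d-2) + \<dots>\<close> with all lower coefficients divisible by \<open>Q\<close>. If \<open>Q\<close> is squarefree,
  then \<open>\<beta> \<mapsto> Tr(y \<beta>) / Q\<close> is integral on the integers of \<open>F\<close>. Suppose moreover that \<open>u\<close> is a unit
  which has the same sign as \<open>y\<close> in every real embedding. Then \<open>\<phi>(\<beta>) = Tr(y \<beta> / u) / Q\<close> is a positive
  integer at every totally positive integer \<open>\<beta>\<close>. Since \<open>Tr(y) = 0\<close> and \<open>Tr(y^2) = 2 Q\<close>, it takes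
  the value 2 at each of the elements \<open>u (y + t)\<close>, and these are totally positive for
  \<open>0 \<le> t \<le> M\<close> if \<open>y\<close> has no conjugate in \<open>[-M, 0]\<close>.

  If \<open>q\<close> is a universal form of rank \<open>r\<close>, then \<open>\<phi> \<circ> q\<close> is a positive definite integer valued
  quadratic form in \<open>d r\<close> variables having more than \<open>M\<close> vectors of norm 2, hence \<open>r\<close> is large
  when \<open>M\<close> is large.

  For \<open>d \<ge> 3\<close> the polynomial \<open>x^d - Q (x - 1) \<Prod>(x + C + 2 i)\<close> with a large prime \<open>Q\<close> is suitable, with
  \<open>u = y - 1\<close>. For \<open>d = 2\<close> take \<open>x^2 - D\<close> and \<open>u = n + s y\<close>, where \<open>n^2 + 1 = s^2 D\<close> with \<open>D\<close> squarefree.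
  The fields are separated by the size of \<open>Q\<close>: integers with small conjugates are orthogonal to
  \<open>y\<close> with respect to the trace form, so they do not generate \<open>F\<close>.
\<close>

section \<open>Algebraic integers\<close>

text \<open>The vector \<open>v\<close> is an eigenvector of the integer matrix \<open>A\<close>, so
  \<open>x\<close> is a root of a monic integer polynomial, the characteristic polynomial of
  \<open>A\<close>.\<close>

lemma algebraic_int_if_int_matrix:
  fixes x :: "'a :: field_char_0" and v :: "nat \<Rightarrow> 'a" and A :: "nat \<Rightarrow> nat \<Rightarrow> int"
  assumes eq: "\<And>i. i < n \<Longrightarrow> x * v i = (\<Sum>j<n. of_int (A i j) * v j)"
    and "k < n" "v k \<noteq> 0"
  shows "algebraic_int x"
proof -
  define B where "B = mat n n (\<lambda>(i,j). A i j)"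
  define C :: "'a mat" where "C = map_mat of_int B"
  have B: "B \<in> carrier_mat n n" by (simp add: B_def)
  have C: "C \<in> carrier_mat n n" by (simp add: C_def B)
  have "eigenvector C (vec n v) x"
    unfolding eigenvector_def
  proof (intro conjI)
    show "vec n v \<in> carrier_vec (dim_row C)" using C by simp
    have "vec n v $ k \<noteq> 0\<^sub>v n $ k" using assms by simp
    then show "vec n v \<noteq> 0\<^sub>v (dim_row C)" using C by auto
    show "C *\<^sub>v vec n v = x \<cdot>\<^sub>v vec n v"
      by (rule eq_vecI)
        (use C in \<open>auto simp: scalar_prod_def C_def B_def eq atLeast0LessThan\<close>)
  qed
  then have "eigenvalue C x" unfolding eigenvalue_def by blast
  then have "poly (char_poly C) x = 0" using eigenvalue_root_char_poly[OF C] by simp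
  moreover have "char_poly C = map_poly of_int (char_poly B)"
    unfolding C_def by (rule of_int_hom.char_poly_hom[OF B])
  moreover have "lead_coeff (char_poly B) = 1"
    using degree_monic_char_poly[OF B] by simp
  ultimately show ?thesis unfolding algebraic_int_altdef_ipoly by auto
qed

section \<open>Finitely generated additive groups and the ring of algebraic integers\<close>

definition int_span :: "('i \<Rightarrow> 'a::comm_ring_1) \<Rightarrow> 'i set \<Rightarrow> 'a set"
  where "int_span v I = range (\<lambda>c. \<Sum>i\<in>I. of_int (c i) * v i)"

lemma int_spanI: "x = (\<Sum>i\<in>I. of_int (c i) * v i) \<Longrightarrow> x \<in> int_span v I"
  unfolding int_span_def by blast

lemma int_span_add: "s \<in> int_span v I \<Longrightarrow> t \<in> int_span v I \<Longrightarrow> s + t \<in> int_span v I"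
proof -
  assume "s \<in> int_span v I" "t \<in> int_span v I"
  then obtain c e where "s = (\<Sum>i\<in>I. of_int (c i) * v i)" "t = (\<Sum>i\<in>I. of_int (e i) * v i)"
    unfolding int_span_def by auto
  then have "s + t = (\<Sum>i\<in>I. of_int (c i + e i) * v i)"
    by (simp add: sum.distrib algebra_simps)
  then show ?thesis by (rule int_spanI[where c = "\<lambda>i. c i + e i"])
qed

lemma int_span_smult: "s \<in> int_span v I \<Longrightarrow> of_int k * s \<in> int_span v I"
proof -
  assume "s \<in> int_span v I"
  then obtain c where "s = (\<Sum>i\<in>I. of_int (c i) * v i)" unfolding int_span_def by auto
  then have "of_int k * s = (\<Sum>i\<in>I. of_int (k * c i) * v i)"
    by (simp add: sum_distrib_left algebra_simps)
  then show ?thesis by (rule int_spanI[where c = "\<lambda>i. k * c i"])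
qed

lemma int_span_0: "0 \<in> int_span v I"
  unfolding int_span_def by (rule range_eqI[where x = "\<lambda>_. 0"]) simp

lemma int_span_sum: "(\<And>j. j \<in> J \<Longrightarrow> f j \<in> int_span v I) \<Longrightarrow> sum f J \<in> int_span v I"
  by (induction J rule: infinite_finite_induct) (auto intro: int_span_add int_span_0)

lemma int_span_base: "finite I \<Longrightarrow> i \<in> I \<Longrightarrow> v i \<in> int_span v I"
proof -
  assume "finite I" "i \<in> I"
  then have "v i = (\<Sum>j\<in>I. of_int (if j = i then 1 else 0) * v j)"
    by (simp add: if_distrib[of of_int] if_distrib[of "\<lambda>x. x * _"] sum.delta cong: if_cong)
  then show ?thesis by (rule int_spanI[where c = "\<lambda>j. if j = i then 1 else 0"])
qed

lemma int_span_stable: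
  assumes "\<And>i. i \<in> I \<Longrightarrow> a * v i \<in> int_span v I" "s \<in> int_span v I"
  shows "a * s \<in> int_span v I"
proof -
  obtain c where "s = (\<Sum>i\<in>I. of_int (c i) * v i)" using assms(2) unfolding int_span_def by auto
  then have "a * s = (\<Sum>i\<in>I. of_int (c i) * (a * v i))"
    by (simp add: sum_distrib_left algebra_simps)
  then show ?thesis using assms(1) by (auto intro!: int_span_sum int_span_smult)
qed

text \<open>Expanding each \<open>x * v i\<close> in the generators yields an integer matrix with
  eigenvalue \<open>x\<close>; enumerating \<open>I\<close> turns it into the indexed criterion
  above.\<close>

lemma algebraic_int_if_int_span_stable:
  fixes x :: "'a :: field_char_0"
  assumes I: "finite I" and st: "\<And>i. i \<in> I \<Longrightarrow> x * v i \<in> int_span v I" and "k \<in> I" "v k \<noteq> 0"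
  shows "algebraic_int x"
proof -
  obtain h where h: "bij_betw h {..<card I} I"
    using ex_bij_betw_nat_finite[OF I] by (auto simp: atLeast0LessThan)
  have "\<forall>i\<in>I. \<exists>c. x * v i = (\<Sum>j\<in>I. of_int (c j) * v j)"
    using st unfolding int_span_def by auto
  then obtain A where A: "\<And>i. i \<in> I \<Longrightarrow> x * v i = (\<Sum>j\<in>I. of_int (A i j) * v j)" by metis
  obtain t where t: "t < card I" "h t = k" using h \<open>k \<in> I\<close> unfolding bij_betw_def by (metis imageE lessThan_iff)
  show ?thesis
  proof (rule algebraic_int_if_int_matrix[of "card I" x "v \<circ> h" "\<lambda>i j. A (h i) (h j)" t])
    fix i assume "i < card I"
    then have "h i \<in> I" using h by (auto simp: bij_betw_def)
    from A[OF this] show "x * (v \<circ> h) i = (\<Sum>j<card I. of_int (A (h i) (h j)) * (v \<circ> h) j)"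
      by (simp add: sum.reindex_bij_betw[OF h, symmetric])
  qed (use t assms in auto)
qed

lemma monic_root_power_reduce:
  fixes a :: "'a :: field_char_0"
  assumes "poly (map_poly of_int p) a = 0" "lead_coeff (p :: int poly) = 1"
  shows "a ^ Polynomial.degree p = (\<Sum>i<Polynomial.degree p. of_int (- coeff p i) * a ^ i)"
proof -
  have "(\<Sum>i\<le>Polynomial.degree p. of_int (coeff p i) * a ^ i) = 0"
    using assms by (simp add: poly_altdef coeff_map_poly degree_map_poly)
  then have "(\<Sum>i<Polynomial.degree p. of_int (coeff p i) * a ^ i) + a ^ Polynomial.degree p = 0"
    using assms(2) by (simp add: lessThan_Suc_atMost[symmetric])
  then show ?thesis by (simp add: sum_negf eq_neg_iff_add_eq_0 add.commute)
qed

text \<open>The products \<open>a ^ i * b ^ j\<close> with exponents below the degrees of monic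
  relations for \<open>a\<close> and \<open>b\<close> generate a group stable under \<open>a\<close>
  and \<open>b\<close>, hence under \<open>a + b\<close> and \<open>a * b\<close>.\<close>

lemma algebraic_int_add_mult:
  fixes a b :: "'a :: field_char_0"
  assumes "algebraic_int a" "algebraic_int b"
  shows "algebraic_int (a + b) \<and> algebraic_int (a * b)"
proof -
  obtain p q where p: "poly (map_poly of_int p) a = 0" "lead_coeff (p :: int poly) = 1"
    and q: "poly (map_poly of_int q) b = 0" "lead_coeff (q :: int poly) = 1"
    using assms unfolding algebraic_int_altdef_ipoly by blast
  define k l where "k = Polynomial.degree p" and "l = Polynomial.degree q"
  \<comment> \<open>Positive degrees put \<open>(0,0)\<close> into the index set, and the generator
    there is 1, hence nonzero.\<close>
  have k0: "k > 0"
  proof (rule ccontr)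
    assume "\<not> k > 0"
    then have "p = 1" using p(2) unfolding k_def by (metis degree_eq_zeroE lead_coeff_pCons(2) neq0_conv one_pCons)
    then show False using p(1) by simp
  qed
  have l0: "l > 0"
  proof (rule ccontr)
    assume "\<not> l > 0"
    then have "q = 1" using q(2) unfolding l_def by (metis degree_eq_zeroE lead_coeff_pCons(2) neq0_conv one_pCons)
    then show False using q(1) by simp
  qed
  define v where "v = (\<lambda>(i::nat,j::nat). a ^ i * b ^ j)"
  define I where "I = {..<k} \<times> {..<l}"
  have fI: "finite I" by (simp add: I_def)
  have base: "a ^ i * b ^ j \<in> int_span v I" if "i < k" "j < l" for i j
    using int_span_base[OF fI, of "(i,j)" v] that by (auto simp: v_def I_def)
  have sa: "a * v t \<in> int_span v I" if tI: "t \<in> I" for t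
  proof -
    obtain i j where t: "t = (i,j)" "i < k" "j < l" using tI by (auto simp: I_def)
    show ?thesis
    proof (cases "Suc i < k")
      case True
      then show ?thesis using base[of "Suc i" j] t by (simp add: v_def mult.assoc)
    next
      case False
      then have "Suc i = k" using t by simp
      then have "a * v t = a ^ k * b ^ j" using t by (auto simp: v_def)
      also have "\<dots> = (\<Sum>i<k. of_int (- coeff p i) * (a ^ i * b ^ j))"
        using monic_root_power_reduce[OF p] by (simp add: k_def sum_distrib_right sum_negf mult.assoc)
      finally show ?thesis using base t by (simp only:) (rule int_span_sum, rule int_span_smult, auto)
    qed
  qed
  have sb: "b * v t \<in> int_span v I" if tI: "t \<in> I" for t
  proof -
    obtain i j where t: "t = (i,j)" "i < k" "j < l" using tI by (auto simp: I_def)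
    show ?thesis
    proof (cases "Suc j < l")
      case True
      then show ?thesis using base[of i "Suc j"] t by (simp add: v_def algebra_simps)
    next
      case False
      then have "Suc j = l" using t by simp
      then have "b * v t = b ^ l * a ^ i" using t by (auto simp: v_def)
      also have "\<dots> = (\<Sum>j<l. of_int (- coeff q j) * (a ^ i * b ^ j))"
        using monic_root_power_reduce[OF q]
        by (simp add: l_def sum_distrib_right sum_distrib_left sum_negf ac_simps)
      finally show ?thesis using base t by (simp only:) (rule int_span_sum, rule int_span_smult, auto)
    qed
  qed
  have ki: "(0,0) \<in> I" "v (0,0) \<noteq> 0" using k0 l0 by (auto simp: I_def v_def)
  show ?thesis
  proof
    show "algebraic_int (a + b)"
      by (rule algebraic_int_if_int_span_stable[where v = v, OF fI _ ki])
        (auto simp: distrib_right intro!: int_span_add sa sb)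
    show "algebraic_int (a * b)"
      by (rule algebraic_int_if_int_span_stable[where v = v, OF fI _ ki])
        (auto simp: mult.assoc intro!: int_span_stable[where a = a] sa sb)
  qed
qed

lemma algebraic_int_add: "algebraic_int a \<Longrightarrow> algebraic_int b \<Longrightarrow> algebraic_int (a + b)"
  and algebraic_int_mult: "algebraic_int a \<Longrightarrow> algebraic_int b \<Longrightarrow> algebraic_int (a * b)"
  for a b :: "'a :: field_char_0"
  using algebraic_int_add_mult by blast+

lemma algebraic_int_sum:
  "(\<And>i. i \<in> I \<Longrightarrow> algebraic_int (f i)) \<Longrightarrow> algebraic_int (sum f I)"
  for f :: "'i \<Rightarrow> 'a :: field_char_0"
  by (induction I rule: infinite_finite_induct) (auto intro: algebraic_int_add)

lemma algebraic_int_power: "algebraic_int a \<Longrightarrow> algebraic_int (a ^ n)"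
  for a :: "'a :: field_char_0"
  by (induction n) (auto intro: algebraic_int_mult)

lemma algebraic_int_poly_of_int:
  "algebraic_int a \<Longrightarrow> algebraic_int (poly (map_poly of_int p) a)"
  for a :: "'a :: field_char_0"
  unfolding poly_altdef
  by (intro algebraic_int_sum algebraic_int_mult algebraic_int_power) (auto simp: coeff_map_poly)

lemma rational_algebraic_int_eq_of_int:
  "algebraic_int x \<Longrightarrow> x \<in> \<rat> \<Longrightarrow> \<exists>k. x = of_int k"
  for x :: "'a :: field_char_0"
  using rational_algebraic_int_is_int[of x] by (auto elim: Ints_cases)

section \<open>Simple extensions with real conjugates\<close>

text \<open>The value type stays open so that one rational polynomial can be evaluated at real and
  at complex conjugates alike.\<close>

definition rpoly :: "rat poly \<Rightarrow> 'a :: field_char_0 \<Rightarrow> 'a"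
  where "rpoly P x = poly (map_poly of_rat P) x"

lemma rpoly_0 [simp]: "rpoly 0 x = 0"
  and rpoly_1 [simp]: "rpoly 1 x = 1"
  and rpoly_pCons [simp]: "rpoly (pCons c P) x = of_rat c + x * rpoly P x"
  and rpoly_add [simp]: "rpoly (P + R) x = rpoly P x + rpoly R x"
  by (simp_all add: rpoly_def hom_distribs)

lemma rpoly_smult [simp]: "rpoly (Polynomial.smult c P) x = of_rat c * rpoly P x"
  by (induction P) (auto simp: of_rat_mult algebra_simps)

lemma rpoly_mult [simp]: "rpoly (P * R) x = rpoly P x * rpoly R x"
  by (induction P) (auto simp: algebra_simps)

lemma rpoly_uminus [simp]: "rpoly (- P) x = - rpoly P x"
  using rpoly_smult[of "-1" P x] by simp

lemma rpoly_diff [simp]: "rpoly (P - R) x = rpoly P x - rpoly R x"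
  using rpoly_add[of P "- R" x] by simp

lemma rpoly_power [simp]: "rpoly (P ^ n) x = rpoly P x ^ n"
  by (induction n) auto

lemma rpoly_monom [simp]: "rpoly (Polynomial.monom c n) x = of_rat c * x ^ n"
  by (simp add: rpoly_def hom_distribs poly_monom map_poly_monom)

lemma rpoly_altdef: "rpoly P x = (\<Sum>i\<le>Polynomial.degree P. of_rat (coeff P i) * x ^ i)"
  by (simp add: rpoly_def poly_altdef)

lemma complex_of_real_of_rat [simp]: "complex_of_real (of_rat q) = of_rat q"
  by (cases q) (simp add: of_rat_rat)

lemma rpoly_of_real: "rpoly P (complex_of_real x) = complex_of_real (rpoly P x)"
  by (induction P) auto

lemma rpoly_of_int_poly [simp]: "rpoly (map_poly of_int p) x = poly (map_poly of_int p) x"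
  by (induction p) auto

lemma rpoly_pcompose: "rpoly (pcompose P R) x = rpoly P (rpoly R x)"
  by (induction P) (auto simp: pcompose_pCons)

section \<open>Homomorphisms and subfields of the ring of complex numbers\<close>

lemma ring_hom_type_algebra_iff:
  "h \<in> Ring.ring_hom (field_of F) (ring_of_type_algebra :: 'b::field ring) \<longleftrightarrow>
    (\<forall>x\<in>F. \<forall>y\<in>F. h (x * y) = h x * h y \<and> h (x + y) = h x + h y) \<and> h 1 = 1"
  by (auto simp: Ring.ring_hom_def ring_of_type_algebra_def)

lemma type_algebra_simps:
  "carrier ring_of_type_algebra = UNIV" "x \<otimes>\<^bsub>ring_of_type_algebra\<^esub> y = x * y"
  "x \<oplus>\<^bsub>ring_of_type_algebra\<^esub> y = x + y" "\<one>\<^bsub>ring_of_type_algebra\<^esub> = 1"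
  "\<zero>\<^bsub>ring_of_type_algebra\<^esub> = 0"
  by (simp_all add: ring_of_type_algebra_def)

lemma subfield_complex_ringI:
  assumes "1 \<in> K" "\<And>a. a \<in> K \<Longrightarrow> - a \<in> K" "\<And>a b. a \<in> K \<Longrightarrow> b \<in> K \<Longrightarrow> a * b \<in> K"
    "\<And>a b. a \<in> K \<Longrightarrow> b \<in> K \<Longrightarrow> a + b \<in> K" "\<And>a. a \<in> K \<Longrightarrow> inverse a \<in> K"
  shows "subfield K complex_ring"
proof -
  interpret C: field complex_ring ..
  have inv: "inv\<^bsub>complex_ring\<^esub> k = inverse k" if "k \<noteq> 0" for k
    using that by (intro C.inv_char) (auto simp: type_algebra_simps)
  have ainv: "\<ominus>\<^bsub>complex_ring\<^esub> k = - k" for k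
    by (rule C.minus_equality) (auto simp: type_algebra_simps)
  have "subring K complex_ring"
    by (rule C.subringI) (use assms in \<open>auto simp: ainv type_algebra_simps\<close>)
  then show ?thesis
    by (rule C.subfieldI') (use assms in \<open>auto simp: inv type_algebra_simps\<close>)
qed

lemma subfield_Rats: "subfield \<rat> complex_ring"
  by (rule subfield_complex_ringI) auto

text \<open>\<open>Y\<close> has as many elements as the degree of \<open>G\<close>, so it contains
  all roots. The last assumption says that \<open>G\<close> is the minimal polynomial of each root,
  in the form needed to transfer relations between conjugates.\<close>

locale real_root_field =
  fixes d :: nat and G :: "int poly" and Y :: "real set" and y\<^sub>0 :: real
  assumes d_pos: "0 < d"
    and degree_G: "Polynomial.degree G = d" and monic_G: "lead_coeff G = 1"
    and card_Y: "card Y = d" and root_G: "\<And>y. y \<in> Y \<Longrightarrow> poly (map_poly of_int G) y = 0"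
    and y\<^sub>0: "y\<^sub>0 \<in> Y"
    and irreducible_G: "\<And>y P. y \<in> Y \<Longrightarrow> Polynomial.degree P < d \<Longrightarrow> rpoly P y = 0 \<Longrightarrow> P = 0"
begin

section \<open>The field generated by one root, and its degree\<close>

definition fld :: "complex set"
  where "fld = range (\<lambda>P. complex_of_real (rpoly P y\<^sub>0))"

text \<open>The embedding replaces \<open>y\<^sub>0\<close> by \<open>y\<close> in a polynomial
  expression. By \<open>emb_rpoly\<close> the choice of the expression does not matter on
  \<open>fld\<close>; elsewhere the value has no meaning.\<close>

definition emb :: "real \<Rightarrow> complex \<Rightarrow> real"
  where "emb y x = rpoly (SOME P. x = complex_of_real (rpoly P y\<^sub>0)) y"

lemma finite_Y: "finite Y"
  using card_Y d_pos card.infinite by fastforce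

lemma rpoly_root_G: "y \<in> Y \<Longrightarrow> rpoly (map_poly of_int G) y = 0"
  using root_G by simp

lemma degree_rat_G: "Polynomial.degree (map_poly of_int G :: rat poly) = d"
  using degree_G by (simp add: degree_map_poly)

lemma rpoly_mod: "y \<in> Y \<Longrightarrow> rpoly (P mod map_poly of_int G) y = rpoly P y"
  using arg_cong[OF div_mult_mod_eq[of P "map_poly of_int G"], of "\<lambda>P. rpoly P y"]
  by (simp add: root_G)

lemma degree_mod_G: "Polynomial.degree (P mod map_poly of_int G :: rat poly) < d"
proof (cases "P mod map_poly of_int G = 0")
  case False
  moreover have "(map_poly of_int G :: rat poly) \<noteq> 0" using degree_rat_G d_pos by auto
  ultimately show ?thesis using degree_mod_less'[of "map_poly of_int G" P] degree_rat_G by simp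
qed (use d_pos in simp)

text \<open>The remainder of \<open>P\<close> modulo \<open>G\<close> has the same values at all
  roots and degree below \<open>d\<close>, so it is zero as soon as it vanishes at one root.\<close>

lemma rpoly_eq_0_transfer: "y \<in> Y \<Longrightarrow> z \<in> Y \<Longrightarrow> rpoly P y = 0 \<Longrightarrow> rpoly P z = 0"
  using rpoly_mod[of y P] rpoly_mod[of z P] irreducible_G[OF _ degree_mod_G, of y P] by auto

lemma emb_rpoly: "y \<in> Y \<Longrightarrow> emb y (complex_of_real (rpoly P y\<^sub>0)) = rpoly P y"
proof -
  assume y: "y \<in> Y"
  define R where "R = (SOME R. complex_of_real (rpoly P y\<^sub>0) = complex_of_real (rpoly R y\<^sub>0))"
  have "complex_of_real (rpoly P y\<^sub>0) = complex_of_real (rpoly R y\<^sub>0)"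
    unfolding R_def by (rule someI[of _ P]) simp
  then have "rpoly (P - R) y\<^sub>0 = 0" by simp
  then have "rpoly (P - R) y = 0" using rpoly_eq_0_transfer[OF y\<^sub>0 y] by blast
  then show ?thesis unfolding emb_def R_def[symmetric] by simp
qed

lemma fldI: "complex_of_real (rpoly P y\<^sub>0) \<in> fld"
  unfolding fld_def by blast

lemma fldE: "x \<in> fld \<Longrightarrow> (\<And>P. x = complex_of_real (rpoly P y\<^sub>0) \<Longrightarrow> thesis) \<Longrightarrow> thesis"
  unfolding fld_def by blast

lemma fld_closed:
  "a \<in> fld \<Longrightarrow> b \<in> fld \<Longrightarrow> a + b \<in> fld" "a \<in> fld \<Longrightarrow> b \<in> fld \<Longrightarrow> a * b \<in> fld"
  "a \<in> fld \<Longrightarrow> b \<in> fld \<Longrightarrow> a - b \<in> fld" "1 \<in> fld" "0 \<in> fld" "a \<in> fld \<Longrightarrow> - a \<in> fld"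
  using fldI[of 0] fldI[of 1]
  by (auto elim!: fldE simp flip: of_real_add of_real_mult of_real_diff of_real_minus
      rpoly_add rpoly_mult rpoly_diff rpoly_uminus intro: fldI)

text \<open>If \<open>P\<close> does not vanish at \<open>y\<^sub>0\<close>, the cofactor of
  \<open>gcd P g\<close> in \<open>g\<close> does, so it has full degree and the gcd is constant.
  Bezout's identity at \<open>y\<^sub>0\<close> then exhibits the inverse.\<close>

lemma fld_inverse: "a \<in> fld \<Longrightarrow> inverse a \<in> fld"
proof (cases "a = 0")
  case False
  assume "a \<in> fld"
  then obtain P where P: "a = complex_of_real (rpoly P y\<^sub>0)" by (elim fldE)
  define g where "g = (map_poly of_int G :: rat poly)"
  define h where "h = gcd P g"
  have g0: "rpoly g y\<^sub>0 = 0" "g \<noteq> 0" "Polynomial.degree g = d"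
    using rpoly_root_G[OF y\<^sub>0] degree_rat_G d_pos unfolding g_def by auto
  obtain k where k: "g = h * k" unfolding h_def using gcd_dvd2 by blast
  obtain l where l: "P = h * l" unfolding h_def using gcd_dvd1 by blast
  have "rpoly h y\<^sub>0 \<noteq> 0" using False P l by auto
  then have "rpoly k y\<^sub>0 = 0" using g0 k by auto
  then have "\<not> Polynomial.degree k < d" using irreducible_G[OF y\<^sub>0, of k] k g0 by auto
  then have "Polynomial.degree h = 0"
    using k g0 by (auto simp: Polynomial.degree_mult_eq)
  moreover have "h \<noteq> 0" using g0 h_def by auto
  ultimately have "coprime P g"
    unfolding h_def using is_unit_gcd is_unit_iff_degree by blast
  then have "fst (bezout_coefficients P g) * P + snd (bezout_coefficients P g) * g = 1"
    using bezout_coefficients_fst_snd[of P g] by simp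
  from arg_cong[OF this, of "\<lambda>P. rpoly P y\<^sub>0"]
  have "rpoly (fst (bezout_coefficients P g)) y\<^sub>0 * rpoly P y\<^sub>0 = 1" using g0 by simp
  then have "inverse a = complex_of_real (rpoly (fst (bezout_coefficients P g)) y\<^sub>0)"
    using P by (metis inverse_unique mult.commute of_real_1 of_real_mult)
  then show ?thesis by (simp add: fldI)
qed (use fld_closed in auto)

lemma subfield_fld: "subfield fld complex_ring"
  by (rule subfield_complex_ringI) (auto intro: fld_closed fld_inverse)

text \<open>\<open>E k\<close> holds the values of polynomials of degree below \<open>k\<close>.
  Passing to \<open>E (Suc k)\<close> adjoins the power \<open>k\<close> of
  \<open>y\<^sub>0\<close>, which is new because a relation would have degree below
  \<open>d\<close>. Reduction modulo \<open>G\<close> shows that \<open>E d\<close> is the whole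
  field.\<close>

lemma dimension_fld: "ring.dimension complex_ring d \<rat> fld"
proof -
  interpret C: field complex_ring ..
  define E where "E k = {complex_of_real (rpoly P y\<^sub>0) | P. \<forall>i\<ge>k. coeff P i = 0}" for k
  have "k \<le> d \<Longrightarrow> C.dimension k \<rat> (E k)" for k
  proof (induction k)
    case 0
    have "E 0 = {0}"
    proof (intro Set.set_eqI iffI)
      fix u assume "u \<in> E 0"
      then obtain P where "u = complex_of_real (rpoly P y\<^sub>0)" "\<forall>i. coeff P i = 0"
        unfolding E_def by auto
      moreover from this(2) have "P = 0" by (intro poly_eqI) simp
      ultimately show "u \<in> {0}" by simp
    next
      fix u :: complex assume "u \<in> {0}"
      then show "u \<in> E 0" unfolding E_def by (intro CollectI exI[of _ 0]) simp
    qed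
    then have "E 0 = {\<zero>\<^bsub>complex_ring\<^esub>}" by (simp add: type_algebra_simps)
    then show ?case by simp
  next
    case (Suc k)
    have *: "complex_of_real y\<^sub>0 ^ k \<notin> E k"
    proof
      assume "complex_of_real y\<^sub>0 ^ k \<in> E k"
      then obtain P where P: "complex_of_real (y\<^sub>0 ^ k) = complex_of_real (rpoly P y\<^sub>0)"
        "\<forall>i\<ge>k. coeff P i = 0" unfolding E_def by auto
      define R where "R = Polynomial.monom 1 k - P"
      have "rpoly R y\<^sub>0 = 0" using P(1) by (simp add: R_def del: of_real_power)
      moreover have "Polynomial.degree R < d"
      proof -
        have "Polynomial.degree R \<le> k"
          by (rule degree_le) (use P(2) in \<open>auto simp: R_def\<close>)
        then show ?thesis using Suc.prems by simp
      qed
      ultimately have "R = 0" using irreducible_G[OF y\<^sub>0] by blast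
      then have "coeff R k = 0" by simp
      then show False using P(2) by (simp add: R_def)
    qed
    have "C.line_extension \<rat> (complex_of_real y\<^sub>0 ^ k) (E k) = E (Suc k)"
    proof (intro Set.set_eqI iffI)
      fix u assume "u \<in> C.line_extension \<rat> (complex_of_real y\<^sub>0 ^ k) (E k)"
      then obtain q P where u: "u = of_rat q * complex_of_real y\<^sub>0 ^ k + complex_of_real (rpoly P y\<^sub>0)"
        "\<forall>i\<ge>k. coeff P i = 0"
        unfolding C.line_extension_mem_iff E_def
        by (auto simp: type_algebra_simps elim!: Rats_cases)
      then have "u = complex_of_real (rpoly (Polynomial.monom q k + P) y\<^sub>0)"
        by simp
      then show "u \<in> E (Suc k)" unfolding E_def using u(2)
        by (intro CollectI exI[of _ "Polynomial.monom q k + P"]) auto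
    next
      fix u assume "u \<in> E (Suc k)"
      then obtain P where u: "u = complex_of_real (rpoly P y\<^sub>0)" "\<forall>i\<ge>Suc k. coeff P i = 0"
        unfolding E_def by auto
      define R where "R = P - Polynomial.monom (coeff P k) k"
      have "\<forall>i\<ge>k. coeff R i = 0"
        using u(2) by (auto simp: R_def le_Suc_eq)
      then have R: "complex_of_real (rpoly R y\<^sub>0) \<in> E k" unfolding E_def by blast
      have "u = of_rat (coeff P k) * complex_of_real y\<^sub>0 ^ k + complex_of_real (rpoly R y\<^sub>0)"
        by (simp add: R_def u(1))
      then show "u \<in> C.line_extension \<rat> (complex_of_real y\<^sub>0 ^ k) (E k)"
        unfolding C.line_extension_mem_iff
        using R by (auto simp: type_algebra_simps)
    qed
    then show ?case
      using C.Suc_dim[OF _ * Suc.IH] Suc.prems by (auto simp: type_algebra_simps)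
  qed
  from this[of d] have "C.dimension d \<rat> (E d)" by simp
  moreover have "E d = fld"
  proof (intro Set.set_eqI iffI)
    fix u assume "u \<in> E d" then show "u \<in> fld" unfolding E_def fld_def by auto
  next
    fix u assume "u \<in> fld"
    then obtain P where u: "u = complex_of_real (rpoly P y\<^sub>0)" by (elim fldE)
    then have "u = complex_of_real (rpoly (P mod map_poly of_int G) y\<^sub>0)"
      by (simp add: rpoly_mod[OF y\<^sub>0])
    moreover have "\<forall>i\<ge>d. coeff (P mod map_poly of_int G) i = 0"
      using degree_mod_G[of P] by (auto intro!: coeff_eq_0)
    ultimately show "u \<in> E d" unfolding E_def by blast
  qed
  ultimately show ?thesis by simp
qed

lemma number_field_fld: "number_field fld"
proof -
  interpret C: field complex_ring ..
  show ?thesis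
    unfolding number_field_def using subfield_fld C.finite_dimensionI[OF dimension_fld] by blast
qed

lemma field_degree_fld: "field_degree fld = d"
proof -
  interpret C: field complex_ring ..
  show ?thesis
    unfolding field_degree_def using C.dimI[OF subfield_Rats dimension_fld] by (simp add: over_def)
qed

section \<open>Embeddings, conjugates and integrality\<close>

lemma emb_closed:
  assumes "y \<in> Y" "a \<in> fld" "b \<in> fld"
  shows "emb y (a + b) = emb y a + emb y b" "emb y (a * b) = emb y a * emb y b"
    "emb y (a - b) = emb y a - emb y b"
proof -
  obtain P R where PR: "a = complex_of_real (rpoly P y\<^sub>0)" "b = complex_of_real (rpoly R y\<^sub>0)"
    using assms by (elim fldE)
  show "emb y (a + b) = emb y a + emb y b" "emb y (a * b) = emb y a * emb y b"
    "emb y (a - b) = emb y a - emb y b"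
    unfolding PR of_real_add[symmetric] of_real_mult[symmetric] of_real_diff[symmetric]
      rpoly_add[symmetric] rpoly_mult[symmetric] rpoly_diff[symmetric]
    by (simp_all only: emb_rpoly[OF assms(1)]) simp_all
qed

lemma emb_0: "y \<in> Y \<Longrightarrow> emb y 0 = 0" and emb_1: "y \<in> Y \<Longrightarrow> emb y 1 = 1"
  using emb_rpoly[of y 0] emb_rpoly[of y 1] by auto

lemma emb_eq_0_iff: "y \<in> Y \<Longrightarrow> a \<in> fld \<Longrightarrow> emb y a = 0 \<longleftrightarrow> a = 0"
  using rpoly_eq_0_transfer[of y y\<^sub>0] y\<^sub>0 by (auto elim!: fldE simp: emb_rpoly emb_0)

lemma fld_sum: "(\<And>i. i \<in> I \<Longrightarrow> f i \<in> fld) \<Longrightarrow> sum f I \<in> fld"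
  by (induction I rule: infinite_finite_induct) (auto simp: fld_closed)

lemma emb_sum: "y \<in> Y \<Longrightarrow> (\<And>i. i \<in> I \<Longrightarrow> f i \<in> fld) \<Longrightarrow> emb y (sum f I) = (\<Sum>i\<in>I. emb y (f i))"
  by (induction I rule: infinite_finite_induct) (auto simp: emb_0 emb_closed fld_sum)

lemma emb_real_embedding: "y \<in> Y \<Longrightarrow> emb y \<in> real_embeddings fld"
  unfolding real_embeddings_def ring_hom_type_algebra_iff by (simp add: emb_closed emb_1)

lemma fld_of_rat: "of_rat q \<in> fld"
  using fldI[of "[:q:]"] by simp

text \<open>A homomorphism fixes the naturals, hence the integers and the rationals, so it is
  determined by the image of the generator.\<close>

lemma ring_hom_rpoly:
  fixes \<tau> :: "complex \<Rightarrow> 'b :: field_char_0"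
  assumes "\<tau> \<in> Ring.ring_hom (field_of fld) ring_of_type_algebra"
  shows "\<tau> (complex_of_real (rpoly P y\<^sub>0)) = rpoly P (\<tau> (complex_of_real y\<^sub>0))"
proof -
  have add: "\<tau> (a + b) = \<tau> a + \<tau> b" and mult: "\<tau> (a * b) = \<tau> a * \<tau> b"
    if "a \<in> fld" "b \<in> fld" for a b
    using assms that by (auto simp: ring_hom_type_algebra_iff)
  have one: "\<tau> 1 = 1" using assms by (auto simp: ring_hom_type_algebra_iff)
  have zero: "\<tau> 0 = 0" using add[of 0 0] fld_closed(5) by simp
  have nat: "\<tau> (of_nat n) = of_nat n" for n
  proof (induction n)
    case (Suc n)
    then show ?case using add[of 1 "of_nat n"] fld_of_rat[of "of_nat n"] one fld_closed(4) by simp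
  qed (simp add: zero)
  have int: "\<tau> (of_int k) = of_int k" for k
  proof (cases k rule: int_cases2)
    case (nonneg n) then show ?thesis by (simp add: nat)
  next
    case (nonpos n)
    have "\<tau> (of_nat n) + \<tau> (- of_nat n) = 0"
      using add[of "of_nat n" "- of_nat n"] fld_of_rat[of "of_nat n"] fld_of_rat[of "- of_nat n"] zero
      by (simp add: of_rat_minus)
    then show ?thesis using nonpos by (simp add: nat add_eq_0_iff)
  qed
  have rat: "\<tau> (of_rat q) = of_rat q" for q
  proof (cases q)
    case (Fract a b)
    have "\<tau> (of_int b) * \<tau> (of_rat q) = \<tau> (of_int a)"
      using mult[of "of_int b" "of_rat q"] fld_of_rat[of "of_int b"] fld_of_rat[of q] Fract
      by (simp add: of_rat_rat)
    then show ?thesis using Fract by (simp add: int of_rat_rat field_simps)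
  qed
  show ?thesis
  proof (induction P)
    case (pCons c P)
    have "complex_of_real y\<^sub>0 \<in> fld" using fldI[of "[:0,1:]"] by simp
    then show ?case
      using add[OF fld_of_rat[of c] fld_closed(2)[OF _ fldI[of P]]] mult[OF _ fldI[of P]] rat pCons.IH
      by simp
  qed (simp add: zero)
qed

text \<open>One more root besides the \<open>d\<close> real ones would exceed the degree. This
  forces every embedding to be real.\<close>

lemma complex_root_G:
  assumes "poly (map_poly of_int G) (z :: complex) = 0"
  shows "z \<in> complex_of_real ` Y"
proof (rule ccontr)
  assume z: "z \<notin> complex_of_real ` Y"
  define g where "g = (map_poly of_int G :: complex poly)"
  have deg: "Polynomial.degree g = d" using degree_G by (simp add: g_def degree_map_poly)
  then have g0: "g \<noteq> 0" using d_pos by auto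
  have "poly g (complex_of_real y) = 0" if "y \<in> Y" for y
    using rpoly_of_real[of "map_poly of_int G" y] root_G[OF that] by (simp add: g_def)
  then have "insert z (complex_of_real ` Y) \<subseteq> {x. poly g x = 0}"
    using assms by (auto simp: g_def)
  from card_mono[OF poly_roots_finite[OF g0] this]
  have "Suc (card (complex_of_real ` Y)) \<le> d"
    using z finite_Y card_poly_roots_bound[OF g0] deg by simp
  moreover have "card (complex_of_real ` Y) = d"
    using card_Y by (simp add: card_image inj_on_def)
  ultimately show False by simp
qed

lemma ring_hom_rpoly_root:
  fixes \<tau> :: "complex \<Rightarrow> 'b :: field_char_0"
  assumes "\<tau> \<in> Ring.ring_hom (field_of fld) ring_of_type_algebra"
  shows "poly (map_poly of_int G) (\<tau> (complex_of_real y\<^sub>0)) = 0"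
  using ring_hom_rpoly[OF assms, of "map_poly of_int G"] ring_hom_rpoly[OF assms, of 0]
    rpoly_root_G[OF y\<^sub>0] by simp

lemma totally_real_fld: "totally_real fld"
  unfolding totally_real_def complex_embeddings_def
proof (intro ballI)
  fix \<tau> assume t: "\<tau> \<in> Ring.ring_hom (field_of fld) complex_ring"
  obtain y where "\<tau> (complex_of_real y\<^sub>0) = complex_of_real y"
    using complex_root_G[OF ring_hom_rpoly_root[OF t]] by auto
  then show "\<tau> ` fld \<subseteq> \<real>"
    using ring_hom_rpoly[OF t] by (auto elim!: fldE simp: rpoly_of_real)
qed

text \<open>The image of the generator is again a root of \<open>G\<close>, hence in
  \<open>Y\<close>. Only values on \<open>fld\<close> are described, since an embedding is arbitrary
  outside.\<close>

lemma real_embedding_is_emb: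
  assumes "\<sigma> \<in> real_embeddings fld"
  obtains y where "y \<in> Y" "\<And>P. \<sigma> (complex_of_real (rpoly P y\<^sub>0)) = rpoly P y"
proof -
  have t: "\<sigma> \<in> Ring.ring_hom (field_of fld) real_ring"
    using assms by (simp add: real_embeddings_def)
  define y where "y = \<sigma> (complex_of_real y\<^sub>0)"
  have "poly (map_poly of_int G) (complex_of_real y) = 0"
    using ring_hom_rpoly_root[OF t] rpoly_of_real[of "map_poly of_int G" y] by (simp add: y_def)
  then have "y \<in> Y" using complex_root_G by fastforce
  then show ?thesis using that[of y] ring_hom_rpoly[OF t] by (simp add: y_def)
qed

text \<open>Composing \<open>P\<close> with a monic integer relation for its value at
  \<open>y\<close> gives a polynomial vanishing at \<open>y\<close>, hence at every
  conjugate.\<close>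

lemma algebraic_int_conjugate:
  assumes "y \<in> Y" "z \<in> Y" "algebraic_int (rpoly P y)"
  shows "algebraic_int (rpoly P z)"
proof -
  obtain p where p: "poly (map_poly of_int p) (rpoly P y) = 0" "lead_coeff p = 1"
    using assms(3) unfolding algebraic_int_altdef_ipoly by blast
  have "rpoly (pcompose (map_poly of_int p) P) y = 0"
    using p by (simp add: rpoly_pcompose)
  then have "rpoly (pcompose (map_poly of_int p) P) z = 0"
    using rpoly_eq_0_transfer assms by blast
  then show ?thesis
    using p unfolding algebraic_int_altdef_ipoly by (auto simp: rpoly_pcompose)
qed

lemma algebraic_int_Y: "y \<in> Y \<Longrightarrow> algebraic_int y"
  unfolding algebraic_int_altdef_ipoly using root_G monic_G by blast

end

section \<open>Power sums and traces\<close>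

context real_root_field begin

lemma G_eq_prod: "(map_poly of_int G :: real poly) = (\<Prod>y\<in>Y. [:-y, 1:])"
proof (rule poly_eqI_degree_lead_coeff[where n = d and A = Y])
  have deg: "Polynomial.degree (\<Prod>y\<in>Y. [:-y, 1:]) = d"
    using card_Y by (subst degree_prod_eq_sum_degree) auto
  have "lead_coeff (\<Prod>y\<in>Y. [:-y, 1:]) = 1" by (subst lead_coeff_prod) auto
  then show "coeff (map_poly of_int G) d = coeff (\<Prod>y\<in>Y. [:-y, 1:]) d"
    using deg monic_G degree_G by (simp add: coeff_map_poly)
  show "Polynomial.degree (\<Prod>y\<in>Y. [:-y, 1:]) \<le> d" using deg by simp
  show "Polynomial.degree (map_poly of_int G :: real poly) \<le> d"
    using degree_G by (simp add: degree_map_poly)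
  show "poly (map_poly of_int G) z = poly (\<Prod>y\<in>Y. [:-y, 1:]) z" if "z \<in> Y" for z
    using that root_G finite_Y by (auto simp: poly_prod)
qed (simp add: card_Y)

definition power_sum :: "nat \<Rightarrow> real"
  where "power_sum i = (\<Sum>y\<in>Y. y ^ i)"

text \<open>Newton's identities, read off from \<open>G' = (\<Sum>y\<in>Y. G / (X - y))\<close>.\<close>

lemma newton_identity:
  "(\<Sum>i<d - k. of_int (coeff G (Suc k + i)) * power_sum i) = of_nat (Suc k) * of_int (coeff G (Suc k))"
proof -
  define g where "g = (map_poly of_int G :: real poly)"
  define q where "q y = (\<Prod>z\<in>Y - {y}. [:-z, 1:])" for y
  \<comment> \<open>Synthetic division: comparing coefficients in \<open>g = [:-y, 1:] * q y\<close>
    determines those of the quotient from the top degree downwards.\<close>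
  have cf: "coeff (q y) k = (\<Sum>i<d - k. of_int (coeff G (Suc k + i)) * y ^ i)" if y: "y \<in> Y" for y k
  proof (induction "d - k" arbitrary: k)
    case 0
    have "Polynomial.degree (q y) = card (Y - {y})"
      unfolding q_def by (subst degree_prod_eq_sum_degree) auto
    then have "Polynomial.degree (q y) < d"
      using card_Y finite_Y y d_pos by simp
    then show ?case using 0 by (auto intro!: coeff_eq_0)
  next
    case (Suc n)
    have "g = [:-y, 1:] * q y"
      unfolding g_def G_eq_prod q_def using finite_Y y by (simp add: prod.remove)
    then have "coeff g (Suc k) = coeff (q y) k - y * coeff (q y) (Suc k)" by simp
    then have "coeff (q y) k = of_int (coeff G (Suc k)) + y * coeff (q y) (Suc k)"
      by (simp add: g_def coeff_map_poly)
    also have "coeff (q y) (Suc k) = (\<Sum>i<d - Suc k. of_int (coeff G (Suc (Suc k) + i)) * y ^ i)"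
      using Suc.hyps(1)[of "Suc k"] Suc.hyps(2) by simp
    also have "of_int (coeff G (Suc k)) + y * \<dots> = (\<Sum>i<Suc (d - Suc k). of_int (coeff G (Suc k + i)) * y ^ i)"
      by (subst sum.lessThan_Suc_shift) (simp add: sum_distrib_left algebra_simps)
    also have "Suc (d - Suc k) = d - k" using Suc.hyps(2) by simp
    finally show ?case .
  qed
  have "pderiv g = (\<Sum>y\<in>Y. q y)"
    unfolding g_def G_eq_prod pderiv_prod q_def by (simp add: pderiv_pCons)
  then have "of_nat (Suc k) * of_int (coeff G (Suc k)) = (\<Sum>y\<in>Y. coeff (q y) k)"
    using coeff_pderiv[of g k] by (simp add: coeff_sum g_def coeff_map_poly)
  also have "\<dots> = (\<Sum>y\<in>Y. \<Sum>i<d - k. of_int (coeff G (Suc k + i)) * y ^ i)"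
    by (intro sum.cong) (auto simp: cf)
  also have "\<dots> = (\<Sum>i<d - k. of_int (coeff G (Suc k + i)) * power_sum i)"
    by (subst sum.swap) (simp add: power_sum_def sum_distrib_left)
  finally show ?thesis by simp
qed

lemma power_sum_Rats: "i < d \<Longrightarrow> power_sum i \<in> \<rat>"
proof (induction i rule: less_induct)
  case (less i)
  \<comment> \<open>With this index \<open>power_sum i\<close> is the last term in Newton's
    identity, and its factor is the leading coefficient 1.\<close>
  define k where "k = d - Suc i"
  have k: "d - k = Suc i" "Suc k + i = d" using less.prems by (auto simp: k_def)
  have "(\<Sum>j<i. of_int (coeff G (Suc k + j)) * power_sum j) + power_sum i
      = of_nat (Suc k) * of_int (coeff G (Suc k))"
    using newton_identity[of k] monic_G degree_G unfolding k(1) by (simp add: k(2) del: add_Suc)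
  then have "power_sum i = of_nat (Suc k) * of_int (coeff G (Suc k))
      - (\<Sum>j<i. of_int (coeff G (Suc k + j)) * power_sum j)"
    by linarith
  also have "\<dots> \<in> \<rat>"
    by (intro Rats_diff Rats_mult Rats_sum) (use less in auto)
  finally show ?case .
qed

text \<open>Reduction modulo \<open>G\<close> leaves only power sums of exponent below
  \<open>d\<close>, which are rational.\<close>

lemma trace_Rats: "(\<Sum>y\<in>Y. rpoly P y) \<in> \<rat>"
proof -
  define R where "R = P mod map_poly of_int G"
  have "(\<Sum>y\<in>Y. rpoly P y) = (\<Sum>y\<in>Y. rpoly R y)"
    unfolding R_def by (intro sum.cong) (simp_all add: rpoly_mod)
  also have "\<dots> = (\<Sum>i\<le>Polynomial.degree R. of_rat (coeff R i) * power_sum i)"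
    unfolding rpoly_altdef by (subst sum.swap) (simp add: power_sum_def sum_distrib_left)
  also have "\<dots> \<in> \<rat>"
    using degree_mod_G[of P] by (intro Rats_sum Rats_mult power_sum_Rats) (auto simp: R_def)
  finally show ?thesis .
qed

end

section \<open>Lower bounds for the rank\<close>

text \<open>Complete the square in the last variable; the remaining form in the first
  \<open>r\<close> variables is again positive definite, and induction applies.\<close>

lemma positive_definite_form_sum_squares:
  "positive_definite_form r b \<Longrightarrow>
    \<exists>L. \<forall>x. qform r b x = (\<Sum>t<r. (\<Sum>i<r. L t i * x i)\<^sup>2)"
proof (induction r arbitrary: b)
  case 0
  show ?case by (simp add: qform_def)
next
  case (Suc r)
  define s where "s x = (\<Sum>i<r. b i r * x i)" for x :: "nat \<Rightarrow> real"
  \<comment> \<open>These are the coefficients of the form minus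
    \<open>(s x)^2 / (4 * b r r)\<close>; mixed products occur twice in the square.\<close>
  define b' where "b' i j = b i j - (if i = j then (b i r)\<^sup>2 else 2 * b i r * b j r) / (4 * b r r)" for i j
  have step: "qform (Suc r) b x = qform r b x + s x * x r + b r r * (x r)\<^sup>2" for x
    by (simp add: qform_def s_def lessThan_Suc_atMost[symmetric] sum_distrib_left power2_eq_square
        algebra_simps)
  have pos: "b r r > 0"
  proof -
    have "qform (Suc r) b (\<lambda>i. if i = r then 1 else 0) > 0"
      using Suc.prems unfolding positive_definite_form_def by auto
    moreover have "qform r b (\<lambda>i. if i = r then 1 else 0) = 0"
      unfolding qform_def by (intro sum.neutral) auto
    ultimately show ?thesis unfolding step s_def by simp
  qed
  have sq: "(s x)\<^sup>2 = qform r (\<lambda>i j. if i = j then (b i r)\<^sup>2 else 2 * b i r * b j r) x" for x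
  proof -
    have "(\<Sum>i<n. b i r * x i)\<^sup>2 = qform n (\<lambda>i j. if i = j then (b i r)\<^sup>2 else 2 * b i r * b j r) x" for n
    proof (induction n)
      case (Suc n)
      have "(\<Sum>i\<le>n. (if i = n then (b i r)\<^sup>2 else 2 * b i r * b n r) * x i * x n)
          = (\<Sum>i<n. 2 * b i r * b n r * x i * x n) + (b n r)\<^sup>2 * x n * x n"
        by (simp add: lessThan_Suc_atMost[symmetric])
      then show ?case
        using Suc.IH by (simp add: qform_def power2_sum sum_distrib_left sum_distrib_right
            power2_eq_square algebra_simps)
    qed (simp add: qform_def)
    then show ?thesis unfolding s_def .
  qed
  have b': "qform r b' x = qform r b x - (s x)\<^sup>2 / (4 * b r r)" for x
    unfolding sq unfolding qform_def b'_def
    by (simp add: sum_subtractf[symmetric] sum_divide_distrib diff_divide_distrib left_diff_distrib)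
  have complete: "qform (Suc r) b x = qform r b' x + (sqrt (b r r) * x r + s x / (2 * sqrt (b r r)))\<^sup>2" for x
  proof -
    define w where "w = sqrt (b r r)"
    have w: "w > 0" "b r r = w\<^sup>2" using pos by (auto simp: w_def)
    have "2 * (w * x r) * (s x / (2 * w)) = s x * x r" using w(1) by simp
    then have "(w * x r + s x / (2 * w))\<^sup>2 = w\<^sup>2 * (x r)\<^sup>2 + s x * x r + (s x)\<^sup>2 / (4 * w\<^sup>2)"
      unfolding power2_sum by (simp add: power_mult_distrib power_divide)
    then show ?thesis using w(1) unfolding step b' w_def[symmetric] w(2) by simp
  qed
  have "positive_definite_form r b'"
    unfolding positive_definite_form_def
  proof (intro allI impI)
    fix x :: "nat \<Rightarrow> real" assume x: "\<exists>i<r. x i \<noteq> 0"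
    \<comment> \<open>The last coordinate is chosen to make the completed square vanish, so the full
      form at \<open>z\<close> equals the remaining form at \<open>x\<close>.\<close>
    define z where "z = x(r := - s x / (2 * b r r))"
    have "qform r b' z = qform r b' x" unfolding qform_def z_def by (intro sum.cong) auto
    moreover have "s z = s x" unfolding s_def z_def by (intro sum.cong) auto
    moreover have "sqrt (b r r) * z r + s x / (2 * sqrt (b r r)) = 0"
      using pos by (simp add: z_def field_simps)
    ultimately have "qform (Suc r) b z = qform r b' x" using complete[of z] by simp
    moreover have "qform (Suc r) b z > 0"
    proof -
      obtain i where "i < r" "x i \<noteq> 0" using x by blast
      then have "i < Suc r \<and> z i \<noteq> 0" by (simp add: z_def)
      then show ?thesis using Suc.prems unfolding positive_definite_form_def by blast
    qed
    ultimately show "qform r b' x > 0" by simp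
  qed
  then obtain L where L: "\<And>x. qform r b' x = (\<Sum>t<r. (\<Sum>i<r. L t i * x i)\<^sup>2)"
    using Suc.IH by blast
  define L' where "L' t i = (if t = r then if i = r then sqrt (b r r) else b i r / (2 * sqrt (b r r))
      else if i = r then 0 else L t i)" for t i
  have "qform (Suc r) b x = (\<Sum>t<Suc r. (\<Sum>i<Suc r. L' t i * x i)\<^sup>2)" for x
  proof -
    have "(\<Sum>i<r. L' t i * x i) = (\<Sum>i<r. L t i * x i)" if "t < r" for t
      using that by (intro sum.cong) (auto simp: L'_def)
    moreover have "(\<Sum>i<r. L' r i * x i) = s x / (2 * sqrt (b r r))"
      unfolding s_def sum_divide_distrib by (intro sum.cong) (auto simp: L'_def)
    moreover have "L' r r = sqrt (b r r)" "\<And>t. t < r \<Longrightarrow> L' t r = 0" by (auto simp: L'_def)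
    ultimately show ?thesis unfolding complete L by (simp add: add.commute)
  qed
  then show ?case by blast
qed

text \<open>\<open>Q_radical\<close> is the consequence of squarefreeness that is used.
  \<open>U\<close> and \<open>V\<close> give a unit and its inverse at every root; as integer
  polynomials they are compatible with all embeddings. \<open>gap_Y\<close> ensures that
  \<open>y + t\<close> has the sign of \<open>y\<close> for
  \<open>0 \<le> t \<le> M\<close>.\<close>

locale ramified_root_field = real_root_field +
  fixes Q :: int and U V :: "int poly" and M :: nat
  assumes d_ge: "2 \<le> d" and Q_pos: "0 < Q"
    and coeff_G1: "coeff G (d - 1) = 0" and coeff_G2: "coeff G (d - 2) = - Q"
    and Q_dvd: "\<And>k. k < d \<Longrightarrow> Q dvd coeff G k"
    and Q_radical: "\<And>t. Q dvd t ^ d \<Longrightarrow> Q dvd t"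
    and unit_U: "\<And>y. y \<in> Y \<Longrightarrow> poly (map_poly of_int U) y * poly (map_poly of_int V) y = 1"
    and sign_U: "\<And>y. y \<in> Y \<Longrightarrow> y * poly (map_poly of_int U) y > 0"
    and gap_Y: "\<And>y. y \<in> Y \<Longrightarrow> 0 < y \<or> y < - real M"
begin

section \<open>Small power sums and divisibility of traces by \<open>Q\<close>\<close>

lemma root_power_d: "y \<in> Y \<Longrightarrow> y ^ d = (\<Sum>i<d. of_int (- coeff G i) * y ^ i)"
  using monic_root_power_reduce[OF root_G monic_G] degree_G by simp

lemma power_sum_1: "power_sum 1 = 0"
proof -
  have "d - (d - 2) = 2" "Suc (d - 2) = d - 1" "Suc (d - 1) = d" using d_ge by auto
  then show ?thesis
    using newton_identity[of "d - 2"] coeff_G1 monic_G degree_G by (simp add: numeral_2_eq_2)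
qed

lemma power_sum_0: "power_sum 0 = d"
  by (simp add: power_sum_def card_Y)

lemma power_sum_2: "power_sum 2 = 2 * of_int Q"
\<comment> \<open>\<open>newton_identity\<close> starts at the coefficient of degree 1, but for
  \<open>d = 2\<close> the coefficient \<open>- Q\<close> is the constant one; there
  \<open>y ^ 2\<close> is simply \<open>Q\<close>.\<close>
proof (cases "d = 2")
  case True
  have "y ^ 2 = of_int Q" if "y \<in> Y" for y
    using root_power_d[OF that] coeff_G1 coeff_G2 unfolding True by (simp add: numeral_2_eq_2)
  then show ?thesis by (simp add: power_sum_def card_Y True)
next
  case False
  then have d: "d - (d - 3) = 3" "Suc (d - 3) = d - 2" "Suc (d - 2) = d - 1" "Suc (d - 1) = d"
    "Suc (Suc (d - 2)) = d" "real (d - 2) = real d - 2"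
    using d_ge by auto
  have "(\<Sum>i<3. of_int (coeff G (d - 2 + i)) * power_sum i) = real (d - 2) * of_int (coeff G (d - 2))"
    using newton_identity[of "d - 3"] unfolding d(1,2) .
  then show ?thesis
    using coeff_G1 coeff_G2 monic_G degree_G power_sum_1 power_sum_0 d
    by (simp add: numeral_3_eq_3 numeral_2_eq_2 algebra_simps)
qed

text \<open>The power \<open>d\<close> of the quotient is \<open>y ^ d / Q\<close>, an integer
  polynomial in \<open>y\<close> because \<open>Q\<close> divides all lower coefficients of
  \<open>G\<close>.\<close>

lemma algebraic_int_root_div:
  assumes "y \<in> Y"
  shows "algebraic_int (y / root d (of_int Q))"
proof -
  have "\<forall>i. \<exists>k. i < d \<longrightarrow> coeff G i = Q * k" using Q_dvd by (auto elim!: dvdE)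
  then obtain c where c: "\<And>i. i < d \<Longrightarrow> coeff G i = Q * c i" by metis
  have "y ^ d = (\<Sum>i<d. of_int (- coeff G i) * y ^ i)" by (rule root_power_d[OF assms])
  also have "\<dots> = of_int Q * (\<Sum>i<d. of_int (- c i) * y ^ i)"
    unfolding sum_distrib_left by (intro sum.cong) (auto simp: c)
  finally have "(y / root d (of_int Q)) ^ d = (\<Sum>i<d. of_int (- c i) * y ^ i)"
    using Q_pos d_ge by (simp add: power_divide)
  moreover have "algebraic_int (\<Sum>i<d. of_int (- c i) * y ^ i)"
    by (intro algebraic_int_sum algebraic_int_mult algebraic_int_power algebraic_int_Y[OF assms]) auto
  ultimately show ?thesis
    using d_pos
    by (intro algebraic_int_root[where p = "Polynomial.monom 1 d" and
          y = "\<Sum>i<d. of_int (- c i) * y ^ i" and x = "y / root d (of_int Q)"])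
      (simp_all add: degree_monom_eq poly_monom)
qed

text \<open>The trace is an ordinary integer \<open>t\<close>. Divided by the \<open>d\<close>-th
  root of \<open>Q\<close> it remains an algebraic integer, so \<open>t ^ d / Q\<close> is an
  integer, and \<open>Q_radical\<close> applies.\<close>

lemma Q_dvd_trace:
  assumes "\<And>y. y \<in> Y \<Longrightarrow> algebraic_int (rpoly P y)"
  shows "\<exists>k. (\<Sum>y\<in>Y. y * rpoly P y) = of_int (Q * k)"
proof -
  define T where "T = (\<Sum>y\<in>Y. y * rpoly P y)"
  define \<eta> where "\<eta> = root d (of_int Q)"
  have \<eta>: "\<eta> ^ d = of_int Q" using Q_pos d_pos by (simp add: \<eta>_def)
  have "T = (\<Sum>y\<in>Y. rpoly ([:0, 1:] * P) y)" by (simp add: T_def)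
  then have "T \<in> \<rat>" using trace_Rats by metis
  moreover have "algebraic_int T"
    unfolding T_def by (intro algebraic_int_sum algebraic_int_mult algebraic_int_Y assms)
  ultimately obtain t where t: "T = of_int t" using rational_algebraic_int_eq_of_int by blast
  have "T / \<eta> = (\<Sum>y\<in>Y. y / \<eta> * rpoly P y)" by (simp add: T_def sum_divide_distrib)
  then have "algebraic_int (T / \<eta>)"
    by (simp only:) (intro algebraic_int_sum algebraic_int_mult assms
        algebraic_int_root_div[folded \<eta>_def])
  then have "algebraic_int ((T / \<eta>) ^ d)" by (rule algebraic_int_power)
  moreover have eq: "(T / \<eta>) ^ d = of_int (t ^ d) / of_int Q" by (simp add: power_divide \<eta> t)
  ultimately obtain k where "of_int (t ^ d) / of_int Q = (of_int k :: real)"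
    using rational_algebraic_int_eq_of_int[of "(T / \<eta>) ^ d"] by auto
  then have "real_of_int (t ^ d) = of_int (Q * k)" using Q_pos by (simp add: field_simps)
  then have "t ^ d = Q * k" by linarith
  then have "Q dvd t" using Q_radical by simp
  then show ?thesis using t by (auto simp: T_def elim!: dvdE)
qed

section \<open>The positive integral functional and the elements of value 2\<close>

definition wt :: "real \<Rightarrow> real"
  where "wt y = y * poly (map_poly of_int V) y / of_int Q"

text \<open>This is the trace functional \<phi> of the overview, with division by the unit expressed
  as multiplication by \<open>V\<close>.\<close>

definition phi :: "complex \<Rightarrow> real"
  where "phi a = (\<Sum>y\<in>Y. wt y * emb y a)"

lemma wt_pos: "y \<in> Y \<Longrightarrow> wt y > 0"
proof -
  assume y: "y \<in> Y"
  define u v where "u = poly (map_poly of_int U) y" and "v = poly (map_poly of_int V) y"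
  have "y * u > 0" "u * v = 1" using sign_U[OF y] unit_U[OF y] by (auto simp: u_def v_def)
  then have "v \<noteq> 0" by auto
  \<comment> \<open>Multiplying by a square carries the sign condition from the unit to its
    inverse.\<close>
  then have "(y * u) * v\<^sup>2 > 0" using \<open>y * u > 0\<close> by simp
  moreover have "(y * u) * v\<^sup>2 = (u * v) * (y * v)" by (simp add: power2_eq_square)
  ultimately have "y * v > 0" using \<open>u * v = 1\<close> by simp
  then show ?thesis using Q_pos by (simp add: wt_def v_def)
qed

text \<open>Multiplication by \<open>V\<close> keeps the conjugates integral, so the trace is
  divisible by the denominator \<open>Q\<close>.\<close>

lemma phi_integer: "a \<in> ring_of_integers fld \<Longrightarrow> \<exists>k. phi a = of_int k"
proof -
  assume a: "a \<in> ring_of_integers fld"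
  then obtain P where P: "a = complex_of_real (rpoly P y\<^sub>0)"
    unfolding ring_of_integers_def by (auto elim: fldE)
  have "algebraic_int (rpoly P y\<^sub>0)" using a P unfolding ring_of_integers_def by simp
  then have "algebraic_int (rpoly P y)" if "y \<in> Y" for y
    using algebraic_int_conjugate[OF y\<^sub>0 that] by blast
  then have "algebraic_int (rpoly (map_poly of_int V * P) y)" if "y \<in> Y" for y
    using that algebraic_int_mult[OF algebraic_int_poly_of_int[OF algebraic_int_Y]]
    by (simp only: rpoly_mult rpoly_of_int_poly)
  then obtain k where "(\<Sum>y\<in>Y. y * rpoly (map_poly of_int V * P) y) = of_int (Q * k)"
    using Q_dvd_trace by blast
  moreover have "phi a = (\<Sum>y\<in>Y. y * rpoly (map_poly of_int V * P) y) / of_int Q"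
    unfolding phi_def wt_def sum_divide_distrib by (intro sum.cong) (auto simp: P emb_rpoly)
  ultimately show ?thesis using Q_pos by auto
qed

definition alpha :: "nat \<Rightarrow> complex"
  where "alpha r = complex_of_real (rpoly (map_poly of_int U * [:of_nat r, 1:]) y\<^sub>0)"

lemma rpoly_alpha:
  "rpoly (map_poly of_int U * [:of_nat r, 1:]) y = poly (map_poly of_int U) y * (y + of_nat r)"
  unfolding rpoly_mult rpoly_of_int_poly by simp

lemma emb_alpha: "y \<in> Y \<Longrightarrow> emb y (alpha r) = poly (map_poly of_int U) y * (y + r)"
  unfolding alpha_def by (subst emb_rpoly) (simp_all only: rpoly_alpha)

lemma inj_alpha: "inj alpha"
proof (rule injI)
  fix r s assume "alpha r = alpha s"
  then have "poly (map_poly of_int U) y\<^sub>0 * (y\<^sub>0 + r) = poly (map_poly of_int U) y\<^sub>0 * (y\<^sub>0 + s)"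
    using emb_alpha[OF y\<^sub>0] by metis
  moreover have "poly (map_poly of_int U) y\<^sub>0 \<noteq> 0" using sign_U[OF y\<^sub>0] by auto
  ultimately show "r = s" by simp
qed

text \<open>In every embedding both factors have the sign of \<open>y\<close>: the unit by
  \<open>sign_U\<close>, and \<open>y + r\<close> because \<open>y\<close> is positive or below
  \<open>- M\<close>.\<close>

lemma alpha_totally_positive: "r \<le> M \<Longrightarrow> alpha r \<in> totally_positive_integers fld"
proof -
  assume r: "r \<le> M"
  have "algebraic_int (poly (map_poly of_int U) y\<^sub>0 * (y\<^sub>0 + of_nat r))"
    using algebraic_int_Y[OF y\<^sub>0]
    by (intro algebraic_int_mult algebraic_int_add algebraic_int_poly_of_int) auto
  then have "alpha r \<in> ring_of_integers fld"
    unfolding ring_of_integers_def alpha_def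
    using fldI[of "map_poly of_int U * [:of_nat r, 1:]"] by (simp only: rpoly_alpha algebraic_int_of_real_iff mem_Collect_eq)
  moreover have "\<sigma> (alpha r) > 0" if \<sigma>: "\<sigma> \<in> real_embeddings fld" for \<sigma>
  proof -
    obtain y where y: "y \<in> Y" "\<And>P. \<sigma> (complex_of_real (rpoly P y\<^sub>0)) = rpoly P y"
      using real_embedding_is_emb[OF \<sigma>] by metis
    have "\<sigma> (alpha r) = poly (map_poly of_int U) y * (y + r)"
      unfolding alpha_def y(2) by (rule rpoly_alpha)
    moreover have "\<dots> > 0"
    proof (cases "y > 0")
      case True
      then show ?thesis using sign_U[OF y(1)] by (simp add: zero_less_mult_iff)
    next
      case False
      then have "y < 0" "y + r < 0" using gap_Y[OF y(1)] r by auto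
      then show ?thesis using sign_U[OF y(1)] by (simp add: zero_less_mult_iff)
    qed
    ultimately show ?thesis by simp
  qed
  ultimately show ?thesis unfolding totally_positive_integers_def by blast
qed

text \<open>\<open>U\<close> and \<open>V\<close> cancel, leaving the trace of
  \<open>y^2 + r * y\<close> divided by \<open>Q\<close>; the dependence on \<open>r\<close>
  disappears because the roots sum to 0.\<close>

lemma phi_alpha: "phi (alpha r) = 2"
proof -
  have "phi (alpha r) = (\<Sum>y\<in>Y. (y\<^sup>2 + of_nat r * y) / of_int Q)"
    unfolding phi_def
  proof (intro sum.cong refl)
    fix y assume y: "y \<in> Y"
    have "wt y * emb y (alpha r) =
        (poly (map_poly of_int U) y * poly (map_poly of_int V) y) * (y * (y + r)) / of_int Q"
      unfolding wt_def emb_alpha[OF y] by simp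
    then show "wt y * emb y (alpha r) = (y\<^sup>2 + of_nat r * y) / of_int Q"
      unfolding unit_U[OF y] by (simp add: power2_eq_square algebra_simps)
  qed
  also have "\<dots> = (power_sum 2 + r * power_sum 1) / of_int Q"
    by (simp add: power_sum_def sum.distrib sum_distrib_left sum_divide_distrib add_divide_distrib)
  finally show ?thesis using power_sum_1 power_sum_2 Q_pos by simp
qed

lemma ring_of_integers_mult:
  "a \<in> ring_of_integers fld \<Longrightarrow> b \<in> ring_of_integers fld \<Longrightarrow> a * b \<in> ring_of_integers fld"
  unfolding ring_of_integers_def by (simp add: algebraic_int_mult fld_closed)

lemma ring_of_integers_diff:
  "a \<in> ring_of_integers fld \<Longrightarrow> b \<in> ring_of_integers fld \<Longrightarrow> a - b \<in> ring_of_integers fld"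
  unfolding ring_of_integers_def using algebraic_int_add[of a "- b"] by (simp add: fld_closed)

lemma ring_of_integers_sum:
  "(\<And>i. i \<in> I \<Longrightarrow> f i \<in> ring_of_integers fld) \<Longrightarrow> sum f I \<in> ring_of_integers fld"
  unfolding ring_of_integers_def by (simp add: algebraic_int_sum fld_sum)

lemma qform_ring_of_integers:
  "integral_form fld r a \<Longrightarrow> (\<And>i. i < r \<Longrightarrow> x i \<in> ring_of_integers fld) \<Longrightarrow>
    qform r a x \<in> ring_of_integers fld"
  unfolding qform_def integral_form_def
  by (intro ring_of_integers_sum ring_of_integers_mult) simp_all

lemma emb_qform:
  assumes "y \<in> Y" "integral_form fld r a" "\<And>i. i < r \<Longrightarrow> x i \<in> ring_of_integers fld"
  shows "emb y (qform r a x) = qform r (\<lambda>i j. emb y (a i j)) (\<lambda>i. emb y (x i))"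
proof -
  have F: "a i j \<in> fld" "x i \<in> fld" if "j < r" "i \<le> j" for i j
    using that assms(2,3) unfolding integral_form_def ring_of_integers_def by auto
  have "emb y (qform r a x) = (\<Sum>j<r. emb y (\<Sum>i\<le>j. a i j * x i * x j))"
    unfolding qform_def by (rule emb_sum[OF assms(1)]) (auto intro!: fld_sum fld_closed F)
  also have "\<dots> = (\<Sum>j<r. \<Sum>i\<le>j. emb y (a i j * x i * x j))"
    by (intro sum.cong refl emb_sum[OF assms(1)]) (auto intro!: fld_closed F)
  also have "\<dots> = (\<Sum>j<r. \<Sum>i\<le>j. emb y (a i j) * emb y (x i) * emb y (x j))"
    by (intro sum.cong refl) (auto simp: emb_closed[OF assms(1)] fld_closed F)
  finally show ?thesis unfolding qform_def .
qed

text \<open>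
  A universal form \<open>a\<close> turns \<open>\<lambda>x. phi (qform r a x)\<close> into a sum of \<open>d * r\<close> squares of additive
  real-valued functions which is a positive integer at nonzero integral vectors. Vectors
  representing the elements \<open>alpha t\<close> all have the value 2, so they lie in a box and have mutual
  distance at least 1.
\<close>

theorem universal_form_rank_ge:
  assumes univ: "universal_form fld r a" and M: "(4 * (d * m)) ^ (d * m) \<le> M"
  shows "m \<le> r"
proof (rule ccontr)
  assume "\<not> m \<le> r"
  then have rm: "r < m" by simp
  have intf: "integral_form fld r a" and tp: "totally_positive_form fld r a"
    using univ unfolding universal_form_def by auto
  have pd: "positive_definite_form r (\<lambda>i j. emb y (a i j))" if "y \<in> Y" for y
    using tp emb_real_embedding[OF that] unfolding totally_positive_form_def by auto
  have "\<forall>y. \<exists>L. y \<in> Y \<longrightarrow>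
      (\<forall>x. qform r (\<lambda>i j. emb y (a i j)) x = (\<Sum>t<r. (\<Sum>i<r. L t i * x i)\<^sup>2))"
    using positive_definite_form_sum_squares[OF pd] by blast
  then obtain L where L: "\<And>y x. y \<in> Y \<Longrightarrow>
      qform r (\<lambda>i j. emb y (a i j)) x = (\<Sum>t<r. (\<Sum>i<r. L y t i * x i)\<^sup>2)"
    by metis
  \<comment> \<open>These are the coordinates whose squares sum to \<open>phi (qform r a x)\<close>:
    the weights are absorbed as square roots.\<close>
  define c where "c = (\<lambda>(y, t) x. sqrt (wt y) * (\<Sum>i<r. L y t i * emb y (x i)))"
  define J where "J = Y \<times> {..<r}"
  have J: "finite J" "card J = d * r" using finite_Y card_Y by (auto simp: J_def)
  define integral where "integral x \<longleftrightarrow> (\<forall>i<r. x i \<in> ring_of_integers fld)" for x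
  have phi_sq: "phi (qform r a x) = (\<Sum>j\<in>J. (c j x)\<^sup>2)" if "integral x" for x
  proof -
    have "phi (qform r a x) = (\<Sum>y\<in>Y. \<Sum>t<r. (c (y, t) x)\<^sup>2)"
      unfolding phi_def
    proof (intro sum.cong refl)
      fix y assume y: "y \<in> Y"
      have "emb y (qform r a x) = (\<Sum>t<r. (\<Sum>i<r. L y t i * emb y (x i))\<^sup>2)"
        using emb_qform[OF y intf] that L[OF y] unfolding integral_def by simp
      then show "wt y * emb y (qform r a x) = (\<Sum>t<r. (c (y, t) x)\<^sup>2)"
        using wt_pos[OF y] by (simp add: c_def power_mult_distrib flip: sum_distrib_left)
    qed
    then show ?thesis unfolding J_def by (simp add: sum.cartesian_product)
  qed
  have "\<forall>t. \<exists>x. t \<le> M \<longrightarrow> integral x \<and> qform r a x = alpha t"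
    using alpha_totally_positive univ unfolding universal_form_def integral_def by blast
  from choice[OF this] obtain vec_of
    where vec_of: "\<And>t. t \<le> M \<Longrightarrow> integral (vec_of t)" "\<And>t. t \<le> M \<Longrightarrow> qform r a (vec_of t) = alpha t"
    by blast
  \<comment> \<open>A grid of mesh \<open>1 / K\<close> is fine enough: two vectors in one cell have
    a difference of squared norm at most \<open>d * r / K^2\<close>, which is below 1.\<close>
  define K where "K = d * m"
  have K: "0 < K" "d * r < K" using rm d_pos by (auto simp: K_def)
  define f where "f t = restrict (\<lambda>j. floor (of_nat K * c j (vec_of t))) J" for t
  have bound: "\<bar>c j (vec_of t)\<bar> < 2" if "t \<le> M" "j \<in> J" for t j
  proof -
    have "(c j (vec_of t))\<^sup>2 \<le> (\<Sum>j\<in>J. (c j (vec_of t))\<^sup>2)"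
      using J that by (intro member_le_sum) auto
    also have "\<dots> = 2" using phi_sq[OF vec_of(1)] vec_of(2) phi_alpha that by metis
    finally have "(c j (vec_of t))\<^sup>2 < 2\<^sup>2" by simp
    then show ?thesis by (metis power2_abs power2_less_imp_less zero_le_numeral)
  qed
  \<comment> \<open>Coordinates lie strictly between -2 and 2, so each axis meets
    \<open>4 * K\<close> cells. The bound on \<open>M\<close> leaves fewer cells than the
    \<open>M + 1\<close> vectors.\<close>
  have "f ` {..M} \<subseteq> J \<rightarrow>\<^sub>E {- 2 * int K..<2 * int K}"
  proof (intro image_subsetI PiE_I)
    fix t j assume t: "t \<in> {..M}" and j: "j \<in> J"
    have "of_nat K * c j (vec_of t) < of_nat K * 2" "of_nat K * (- 2) \<le> of_nat K * c j (vec_of t)"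
      using bound[of t j] t j K by (auto intro: mult_left_mono simp del: mult_minus_right)
    then have "of_nat K * c j (vec_of t) < of_int (2 * int K)" "of_int (- 2 * int K) \<le> of_nat K * c j (vec_of t)"
      by (simp_all add: mult.commute)
    then show "f t j \<in> {- 2 * int K..<2 * int K}"
      using j by (simp add: f_def floor_less_iff le_floor_iff)
  qed (auto simp: f_def)
  then have "card (f ` {..M}) \<le> card (J \<rightarrow>\<^sub>E {- 2 * int K..<2 * int K})"
    by (intro card_mono finite_PiE J) auto
  also have "\<dots> = (4 * K) ^ (d * r)" using J by (simp add: card_PiE nat_mult_distrib power_mult_distrib)
  also have "\<dots> \<le> (4 * K) ^ (d * m)" using K rm by (intro power_increasing) auto
  also have "\<dots> < card {..M}" using M by (simp add: K_def)
  finally have "\<not> inj_on f {..M}" using pigeonhole by blast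
  then obtain s t where st: "s \<le> M" "t \<le> M" "s \<noteq> t" "f s = f t" unfolding inj_on_def by auto
  \<comment> \<open>The difference of two vectors in one cell is nonzero because
    \<open>alpha\<close> is injective, so its value under \<open>phi\<close> would be a positive
    integer below 1.\<close>
  define z where "z i = vec_of s i - vec_of t i" for i
  have z: "integral z"
    using vec_of(1)[OF st(1)] vec_of(1)[OF st(2)] unfolding integral_def z_def
    by (auto intro: ring_of_integers_diff)
  have small: "\<bar>c j z\<bar> < 1 / K" if jJ: "j \<in> J" for j
  proof -
    obtain y l where j: "j = (y, l)" "y \<in> Y" using jJ by (auto simp: J_def)
    have "emb y (z i) = emb y (vec_of s i) - emb y (vec_of t i)" if "i < r" for i
      using vec_of(1)[OF st(1)] vec_of(1)[OF st(2)] that j unfolding z_def integral_def ring_of_integers_def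
      by (intro emb_closed(3)) auto
    then have "(\<Sum>i<r. L y l i * emb y (z i)) =
        (\<Sum>i<r. L y l i * emb y (vec_of s i)) - (\<Sum>i<r. L y l i * emb y (vec_of t i))"
      by (simp add: right_diff_distrib sum_subtractf)
    then have "c j z = c j (vec_of s) - c j (vec_of t)" by (simp only: j c_def prod.case right_diff_distrib)
    then have "of_nat K * c j z = of_nat K * c j (vec_of s) - of_nat K * c j (vec_of t)"
      by (simp add: right_diff_distrib)
    moreover have "floor (of_nat K * c j (vec_of s)) = floor (of_nat K * c j (vec_of t))"
      using fun_cong[OF st(4), of j] jJ by (simp add: f_def)
    ultimately have "\<bar>of_nat K * c j z\<bar> < 1" by linarith
    then show ?thesis using K by (simp add: abs_mult field_simps)
  qed
  have "phi (qform r a z) \<le> (\<Sum>j\<in>J. (1 / K)\<^sup>2)"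
    unfolding phi_sq[OF z]
  proof (intro sum_mono)
    fix j assume "j \<in> J"
    then have "\<bar>c j z\<bar> \<le> 1 / K" using small by (simp add: less_imp_le)
    then show "(c j z)\<^sup>2 \<le> (1 / K)\<^sup>2" by (metis abs_ge_zero power2_abs power_mono)
  qed
  also have "\<dots> = real (d * r) / K\<^sup>2" using J by (simp add: power_divide)
  also have "\<dots> < 1"
  proof -
    have "d * r < K\<^sup>2" using K self_le_power[of K 2] by simp
    then have "real (d * r) < (real K)\<^sup>2" by (metis of_nat_less_iff of_nat_power)
    then show ?thesis using K(1) by (simp add: divide_less_eq)
  qed
  finally have lt: "phi (qform r a z) < 1" .
  have "\<exists>i<r. z i \<noteq> 0"
  proof (rule ccontr)
    assume "\<not> (\<exists>i<r. z i \<noteq> 0)"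
    then have "vec_of s i = vec_of t i" if "i < r" for i using that by (auto simp: z_def)
    then have "qform r a (vec_of s) = qform r a (vec_of t)" unfolding qform_def by (intro sum.cong) auto
    then show False using vec_of(2) st inj_alpha by (auto simp: inj_def)
  qed
  then obtain i where i: "i < r" "z i \<noteq> 0" by blast
  have "emb y (qform r a z) > 0" if y: "y \<in> Y" for y
  proof -
    have "emb y (z i) \<noteq> 0"
      using emb_eq_0_iff[OF y] z i unfolding integral_def ring_of_integers_def by auto
    then have "qform r (\<lambda>i j. emb y (a i j)) (\<lambda>i. emb y (z i)) > 0"
      using i(1) by (intro pd[OF y, unfolded positive_definite_form_def, rule_format] exI[of _ i] conjI)
    then show ?thesis using emb_qform[OF y intf] z unfolding integral_def by simp
  qed
  then have "phi (qform r a z) > 0"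
    unfolding phi_def using finite_Y y\<^sub>0 wt_pos by (intro sum_pos) auto
  moreover obtain k where "phi (qform r a z) = of_int k"
    using phi_integer qform_ring_of_integers[OF intf] z unfolding integral_def by blast
  ultimately show False using lt by simp
qed

end

section \<open>Isomorphism classes\<close>

context ramified_root_field begin

lemma root_square_le: "y \<in> Y \<Longrightarrow> y\<^sup>2 \<le> 2 * of_int Q"
  using member_le_sum[of y Y "\<lambda>y. y\<^sup>2"] finite_Y power_sum_2 by (simp add: power_sum_def)

text \<open>The trace below is a multiple of \<open>Q\<close> and too small to be nonzero.\<close>

lemma trace_small_eq_0:
  assumes int: "\<And>y. y \<in> Y \<Longrightarrow> algebraic_int (rpoly P y)"
    and B: "\<And>y. y \<in> Y \<Longrightarrow> \<bar>rpoly P y\<bar> \<le> B" and Q: "2 * (real d)\<^sup>2 * B\<^sup>2 < of_int Q"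
  shows "(\<Sum>y\<in>Y. y * rpoly P y) = 0"
proof -
  obtain k where k: "(\<Sum>y\<in>Y. y * rpoly P y) = of_int (Q * k)" using Q_dvd_trace[OF int] by blast
  have B0: "0 \<le> B" using B[OF y\<^sub>0] by linarith
  have "\<bar>\<Sum>y\<in>Y. y * rpoly P y\<bar> \<le> (\<Sum>y\<in>Y. sqrt (2 * of_int Q) * B)"
  proof (intro order.trans[OF sum_abs] sum_mono)
    fix y assume y: "y \<in> Y"
    have "\<bar>y\<bar> \<le> sqrt (2 * of_int Q)" using root_square_le[OF y] by (simp add: real_le_rsqrt)
    then show "\<bar>y * rpoly P y\<bar> \<le> sqrt (2 * of_int Q) * B"
      unfolding abs_mult using B[OF y] Q_pos by (intro mult_mono) auto
  qed
  then have "\<bar>of_int (Q * k)\<bar> \<le> real d * (sqrt (2 * of_int Q) * B)" unfolding k by (simp add: card_Y)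
  \<comment> \<open>Squaring removes the root: the bound becomes \<open>(2 * d^2 * B^2) * Q\<close>,
    which is below \<open>Q^2\<close>.\<close>
  then have "\<bar>of_int (Q * k)\<bar>\<^sup>2 \<le> (real d * (sqrt (2 * of_int Q) * B))\<^sup>2"
    by (intro power_mono) auto
  also have "\<dots> = (2 * (real d)\<^sup>2 * B\<^sup>2) * of_int Q"
    using Q_pos by (simp add: power_mult_distrib)
  also have "\<dots> < of_int Q * of_int Q" using Q Q_pos by simp
  finally have "(of_int Q)\<^sup>2 * (of_int k)\<^sup>2 < (of_int Q)\<^sup>2 * (1 :: real)"
    by (simp add: power_mult_distrib power2_eq_square ac_simps)
  then have "(of_int k)\<^sup>2 < (1 :: real)" using Q_pos by (simp only: mult_less_cancel_left_pos zero_less_power of_int_0_less_iff)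
  then have "k\<^sup>2 < 1" by (simp flip: of_int_power)
  then have "k = 0" using zero_less_power2[of k] by linarith
  then show ?thesis using k by simp
qed

text \<open>An isomorphism would send \<open>z\<^sub>0\<close> to a generator \<theta> of
  \<open>fld\<close> with all conjugates in \<open>Z\<close>. Then \<open>y\<close> has trace
  product 0 with every power of \<theta> below \<open>d\<close>, hence with itself, against
  \<open>power_sum_2\<close>.\<close>

lemma not_isomorphic_if_small_roots:
  assumes E: "real_root_field d H Z z\<^sub>0" and B: "\<And>z. z \<in> Z \<Longrightarrow> \<bar>z\<bar> \<le> B" "1 \<le> B"
    and Q: "2 * (real d)\<^sup>2 * (B ^ d)\<^sup>2 < of_int Q"
  shows "\<not> field_of (real_root_field.fld z\<^sub>0) \<simeq> field_of fld"
proof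
  interpret E: real_root_field d H Z z\<^sub>0 by (rule E)
  assume "field_of E.fld \<simeq> field_of fld"
  then obtain h where h: "h \<in> Ring.ring_hom (field_of E.fld) (field_of fld)"
    and bij: "bij_betw h E.fld fld"
    unfolding is_ring_iso_def ring_iso_def by auto
  have hC: "h \<in> Ring.ring_hom (field_of E.fld) complex_ring"
    using h by (auto simp: Ring.ring_hom_def type_algebra_simps)
  define \<theta> where "\<theta> = h (complex_of_real z\<^sub>0)"
  have "complex_of_real z\<^sub>0 \<in> E.fld" using E.fldI[of "[:0, 1:]"] by simp
  then have "\<theta> \<in> fld" using bij by (auto simp: \<theta>_def bij_betw_def)
  then obtain R where R: "\<theta> = complex_of_real (rpoly R y\<^sub>0)" by (elim fldE)
  have conj: "rpoly R y \<in> Z" if y: "y \<in> Y" for y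
  proof -
    have "emb y \<circ> h \<in> real_embeddings E.fld"
      unfolding real_embeddings_def ring_hom_type_algebra_iff
    proof (intro conjI ballI)
      have H: "h a \<in> fld" if "a \<in> E.fld" for a using bij that by (auto simp: bij_betw_def)
      fix a b assume ab: "a \<in> E.fld" "b \<in> E.fld"
      have "h (a * b) = h a * h b" "h (a + b) = h a + h b"
        using hC ab by (auto simp: ring_hom_type_algebra_iff)
      then show "(emb y \<circ> h) (a * b) = (emb y \<circ> h) a * (emb y \<circ> h) b"
        "(emb y \<circ> h) (a + b) = (emb y \<circ> h) a + (emb y \<circ> h) b"
        using emb_closed[OF y H H] ab by auto
    next
      show "(emb y \<circ> h) 1 = 1" using hC emb_1[OF y] by (simp add: ring_hom_type_algebra_iff)
    qed
    then obtain z where z: "z \<in> Z" "\<And>P. (emb y \<circ> h) (complex_of_real (rpoly P z\<^sub>0)) = rpoly P z"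
      using E.real_embedding_is_emb by metis
    have "emb y \<theta> = z" using z(2)[of "[:0, 1:]"] by (simp add: \<theta>_def)
    then show ?thesis using z(1) R emb_rpoly[OF y] by simp
  qed
  have int: "algebraic_int (rpoly R y)" if "y \<in> Y" for y
    using E.algebraic_int_Y conj[OF that] .
  \<comment> \<open>As \<open>1 \<le> B\<close>, the bound \<open>B ^ d\<close> serves for all these
    powers at once.\<close>
  have tr0: "(\<Sum>y\<in>Y. y * rpoly (R ^ k) y) = 0" if "k < d" for k
  proof (rule trace_small_eq_0[OF _ _ Q])
    fix y assume y: "y \<in> Y"
    show "algebraic_int (rpoly (R ^ k) y)" using int[OF y] by (simp add: algebraic_int_power)
    have "\<bar>rpoly R y\<bar> ^ k \<le> B ^ k" using B(1)[OF conj[OF y]] by (intro power_mono) auto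
    also have "\<dots> \<le> B ^ d" using that B(2) by (intro power_increasing) auto
    finally show "\<bar>rpoly (R ^ k) y\<bar> \<le> B ^ d" by (simp add: power_abs)
  qed
  have "complex_of_real y\<^sub>0 \<in> fld" using fldI[of "[:0, 1:]"] by simp
  then obtain x where "x \<in> E.fld" "complex_of_real y\<^sub>0 = h x"
    using bij by (auto simp: bij_betw_def)
  then obtain P where "complex_of_real y\<^sub>0 = h (complex_of_real (rpoly P z\<^sub>0))" by (auto elim: E.fldE)
  then have P: "complex_of_real y\<^sub>0 = h (complex_of_real (rpoly (P mod map_poly of_int H) z\<^sub>0))"
    by (simp add: E.rpoly_mod[OF E.y\<^sub>0])
  \<comment> \<open>The reduced polynomial has degree below \<open>d\<close>, so only the powers
    treated in \<open>tr0\<close> occur.\<close>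
  define S where "S = P mod map_poly of_int H"
  have "complex_of_real y\<^sub>0 = rpoly S \<theta>"
    using P E.ring_hom_rpoly[OF hC, of S] by (simp add: \<theta>_def S_def)
  then have "complex_of_real y\<^sub>0 = complex_of_real (rpoly (pcompose S R) y\<^sub>0)"
    by (simp add: R rpoly_of_real rpoly_pcompose)
  then have "rpoly ([:0, 1:] - pcompose S R) y\<^sub>0 = 0" by simp
  then have "rpoly ([:0, 1:] - pcompose S R) y = 0" if "y \<in> Y" for y
    using rpoly_eq_0_transfer[OF y\<^sub>0 that] by blast
  then have "y = rpoly S (rpoly R y)" if "y \<in> Y" for y using that by (simp add: rpoly_pcompose)
  then have "power_sum 2 = (\<Sum>y\<in>Y. y * rpoly S (rpoly R y))"
    unfolding power_sum_def power2_eq_square by (intro sum.cong) auto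
  also have "\<dots> = (\<Sum>k\<le>Polynomial.degree S. of_rat (coeff S k) * (\<Sum>y\<in>Y. y * rpoly (R ^ k) y))"
    unfolding rpoly_altdef[of S] sum_distrib_left by (subst sum.swap) (simp add: ac_simps)
  also have "\<dots> = 0"
    using E.degree_mod_G[of P] by (intro sum.neutral ballI, subst tr0) (auto simp: S_def)
  finally show False using power_sum_2 Q_pos by simp
qed

end

text \<open>The fields are chosen successively, each with \<open>Q\<close> so large that the roots
  generating all earlier fields are small in the sense of
  \<open>not_isomorphic_if_small_roots\<close>.\<close>

lemma infinite_nonisomorphic_family:
  fixes d m M :: nat
  assumes ex: "\<And>B :: real. \<exists>G Y y\<^sub>0 Q U V. ramified_root_field d G Y y\<^sub>0 Q U V M \<and> B < of_int Q"
    and M: "(4 * (d * m)) ^ (d * m) \<le> M"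
  shows "\<exists>\<F> :: complex set set. infinite \<F> \<and>
    pairwise (\<lambda>F K. \<not> field_of F \<simeq> field_of K) \<F> \<and>
    (\<forall>F\<in>\<F>. number_field F \<and> totally_real F \<and> field_degree F = d \<and>
      (\<forall>r a. universal_form F r a \<longrightarrow> m \<le> r))"
proof -
  have "\<forall>B. \<exists>T. case T of (G, Y, y\<^sub>0, Q, U, V) \<Rightarrow> ramified_root_field d G Y y\<^sub>0 Q U V M \<and>
      2 * (real d)\<^sup>2 * (B ^ d)\<^sup>2 < of_int Q"
    using ex by (simp add: split_paired_Ex)
  from choice[OF this] obtain T where T: "\<And>B. case T B of (G, Y, y\<^sub>0, Q, U, V) \<Rightarrow>
      ramified_root_field d G Y y\<^sub>0 Q U V M \<and> 2 * (real d)\<^sup>2 * (B ^ d)\<^sup>2 < of_int Q" by blast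
  define Y where "Y B = fst (snd (T B))" for B
  define y\<^sub>0 where "y\<^sub>0 B = fst (snd (snd (T B)))" for B
  define G where "G B = fst (T B)" for B
  define Q where "Q B = fst (snd (snd (snd (T B))))" for B
  define U where "U B = fst (snd (snd (snd (snd (T B)))))" for B
  define V where "V B = snd (snd (snd (snd (snd (T B)))))" for B
  have R: "ramified_root_field d (G B) (Y B) (y\<^sub>0 B) (Q B) (U B) (V B) M"
    and Q: "2 * (real d)\<^sup>2 * (B ^ d)\<^sup>2 < of_int (Q B)" for B
    using T[of B] by (auto simp: G_def Y_def y\<^sub>0_def Q_def U_def V_def split: prod.splits)
  have rr: "real_root_field d (G B) (Y B) (y\<^sub>0 B)" for B
    using R[of B] by (rule ramified_root_field.axioms(1))
  define F where "F B = real_root_field.fld (y\<^sub>0 B)" for B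
  \<comment> \<open>This bounds the roots of the field chosen for \<open>B\<close>; including
    \<open>B\<close> itself makes the iterates \<open>s\<close> increase.\<close>
  define b where "b B = Max (insert B ((\<lambda>y. \<bar>y\<bar>) ` Y B))" for B
  have fin: "finite (Y B)" for B using real_root_field.finite_Y[OF rr] .
  have b: "B \<le> b B" "\<And>y. y \<in> Y B \<Longrightarrow> \<bar>y\<bar> \<le> b B" for B
    unfolding b_def using fin[of B] by (auto intro: Max_ge)
  define s where "s n = (b ^^ n) 1" for n
  have s_Suc: "s (Suc n) = b (s n)" for n by (simp add: s_def)
  have "incseq s" by (rule incseq_SucI) (simp add: s_Suc b)
  then have s1: "1 \<le> s n" for n using incseqD[of s 0 n] by (simp add: s_def)
  have noniso: "\<not> field_of (F (s i)) \<simeq> field_of (F (s j))" if "i < j" for i j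
    unfolding F_def
  proof (rule ramified_root_field.not_isomorphic_if_small_roots[OF R rr _ s1 Q])
    fix z assume "z \<in> Y (s i)"
    then have "\<bar>z\<bar> \<le> s (Suc i)" using b(2) by (simp add: s_Suc)
    also have "\<dots> \<le> s j" using incseqD[OF \<open>incseq s\<close>, of "Suc i" j] that by simp
    finally show "\<bar>z\<bar> \<le> s j" .
  qed
  have nf: "number_field (F B)" for B
    unfolding F_def using real_root_field.number_field_fld[OF rr] .
  have ring: "ring (field_of (F B))" for B
  proof -
    interpret C: field complex_ring ..
    show ?thesis
      by (rule C.subring_is_ring[OF subfieldE(1)]) (use nf[of B] number_field_def in blast)
  qed
  have noniso': "\<not> field_of (F (s i)) \<simeq> field_of (F (s j))" if "i \<noteq> j" for i j
  proof (cases "i < j")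
    case False
    then have "j < i" using that by simp
    then show ?thesis using noniso[of j i] ring_iso_sym[OF ring] by blast
  qed (use noniso in blast)
  have inj: "inj (\<lambda>n. F (s n))"
    by (rule injI) (metis noniso' ring_iso_refl)
  show ?thesis
  proof (intro exI[of _ "range (\<lambda>n. F (s n))"] conjI ballI)
    show "infinite (range (\<lambda>n. F (s n)))" using inj finite_imageD infinite_UNIV_nat by blast
    show "pairwise (\<lambda>F K. \<not> field_of F \<simeq> field_of K) (range (\<lambda>n. F (s n)))"
    proof (rule pairwiseI)
      fix E K assume "E \<in> range (\<lambda>n. F (s n))" "K \<in> range (\<lambda>n. F (s n))" "E \<noteq> K"
      then obtain i j where "E = F (s i)" "K = F (s j)" "i \<noteq> j" by (elim rangeE) auto
      then show "\<not> field_of E \<simeq> field_of K" using noniso' by simp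
    qed
  next
    fix E assume "E \<in> range (\<lambda>n. F (s n))"
    then obtain B where E: "E = F B" by blast
    show "number_field E" using nf E by simp
    show "totally_real E" unfolding E F_def using real_root_field.totally_real_fld[OF rr] .
    show "field_degree E = d" unfolding E F_def using real_root_field.field_degree_fld[OF rr] .
    show "\<forall>r a. universal_form E r a \<longrightarrow> m \<le> r"
      unfolding E F_def using ramified_root_field.universal_form_rank_ge[OF R _ M] by blast
  qed
qed

section \<open>Construction of the fields\<close>

text \<open>The intermediate value theorem gives a root in each of the \<open>n\<close> disjoint
  open intervals between consecutive points.\<close>

lemma alternating_poly_roots:
  fixes p :: "real poly" and t :: "nat \<Rightarrow> real"
  assumes dec: "\<And>k. k < n \<Longrightarrow> t (Suc k) < t k"
    and alt: "\<And>k. k \<le> n \<Longrightarrow> (-1) ^ k * poly p (t k) > 0"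
  shows "\<exists>Y. card Y = n \<and> (\<forall>y\<in>Y. poly p y = 0)"
proof -
  have "\<exists>r. t (Suc k) < r \<and> r < t k \<and> poly p r = 0" if k: "k < n" for k
  proof (rule poly_IVT[OF dec[OF k], simplified, THEN exE])
    have "(-1) ^ k * poly p (t k) > 0" "(-1) ^ k * poly p (t (Suc k)) < 0"
      using alt[of k] alt[of "Suc k"] k by auto
    then have "((-1) ^ k * poly p (t (Suc k))) * ((-1) ^ k * poly p (t k)) < 0"
      by (simp only: mult_neg_pos)
    then show "poly p (t (Suc k)) * poly p (t k) < 0"
      by (cases "even k") auto
  qed blast
  then have "\<forall>k. \<exists>r. k < n \<longrightarrow> t (Suc k) < r \<and> r < t k \<and> poly p r = 0" by blast
  from choice[OF this] obtain r
    where r: "\<And>k. k < n \<Longrightarrow> t (Suc k) < r k" "\<And>k. k < n \<Longrightarrow> r k < t k" "\<And>k. k < n \<Longrightarrow> poly p (r k) = 0"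
    by blast
  have t: "t j \<le> t i" if "i \<le> j" "j \<le> n" for i j
    using that
  proof (induction j)
    case (Suc j)
    then show ?case using dec[of j] by (cases "i = Suc j") (auto intro: order.trans[OF less_imp_le])
  qed simp
  have "r j < r i" if "i < j" "j < n" for i j
    using r(1)[of i] r(2)[of j] t[of "Suc i" j] that by auto
  then have "inj_on r {..<n}"
    by (intro linorder_inj_onI') (metis lessThan_iff less_irrefl)+
  then have "card (r ` {..<n}) = n" by (simp add: card_image)
  then show ?thesis using r(3) by (intro exI[of _ "r ` {..<n}"]) auto
qed

section \<open>Eisenstein's criterion through algebraic integers\<close>

lemma rat_poly_clear_denominators:
  fixes P :: "rat poly"
  shows "\<exists>D p. D \<noteq> 0 \<and> map_poly of_int p = Polynomial.smult (of_int D) P"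
proof (induction P)
  case 0
  show ?case by (rule exI[of _ 1], rule exI[of _ 0]) simp
next
  case (pCons c P)
  then obtain D p where Dp: "D \<noteq> 0" "map_poly of_int p = Polynomial.smult (of_int D) P" by blast
  obtain a b where ab: "c = of_int a / of_int b" "b \<noteq> 0"
    by (metis Fract_of_int_quotient Rat_cases of_int_0_less_iff less_irrefl)
  have "map_poly of_int (pCons (D * a) (Polynomial.smult b p)) = Polynomial.smult (of_int (D * b)) (pCons c P)"
    using ab Dp by (simp add: map_poly_pCons hom_distribs mult.commute)
  then show ?case using Dp(1) ab(2) by (intro exI[of _ "D * b"] exI) auto
qed

text \<open>Among algebraic integers \<open>Q\<close> divides \<open>y ^ e\<close> for
  \<open>e \<ge> d\<close>. A relation of smaller degree then makes \<open>Q\<close> divide a power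
  of an integer that is prime to \<open>Q\<close>.\<close>

lemma eisenstein_root:
  fixes G :: "int poly" and y :: real
  assumes deg: "Polynomial.degree G = d" "0 < d" and monic: "lead_coeff G = 1"
    and Q: "prime Q" and dvd: "\<And>k. k < d \<Longrightarrow> coeff G k = Q * h k" and h0: "\<not> Q dvd h 0"
    and root: "poly (map_poly of_int G) y = 0"
    and P: "Polynomial.degree P < d" "rpoly P y = 0"
  shows "P = 0"
proof (rule ccontr)
  assume "P \<noteq> 0"
  obtain D p' where D: "D \<noteq> 0" "map_poly of_int p' = Polynomial.smult (of_int D) P"
    using rat_poly_clear_denominators by blast
  define p where "p = primitive_part p'"
  have "p' \<noteq> 0" using D \<open>P \<noteq> 0\<close> by auto
  then have cont: "content p = 1" by (simp add: p_def)
  have degp: "Polynomial.degree p < d"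
  proof -
    have "Polynomial.degree (map_poly of_int p' :: rat poly) = Polynomial.degree P" using D by simp
    then show ?thesis using P(1) by (simp add: p_def degree_map_poly)
  qed
  have "poly (map_poly of_int p') y = 0"
    using arg_cong[OF D(2), of "\<lambda>P. rpoly P y"] P(2) by simp
  moreover have "p' = Polynomial.smult (content p') p" by (simp add: p_def)
  ultimately have "of_int (content p') * poly (map_poly of_int p) y = 0"
    by (metis of_int_hom.map_poly_hom_smult poly_smult)
  then have p0: "poly (map_poly of_int p) y = 0" using \<open>p' \<noteq> 0\<close> by simp
  have int_y: "algebraic_int y" unfolding algebraic_int_altdef_ipoly using root monic by blast
  have Q0: "Q \<noteq> 0" using Q by auto
  have "\<exists>j. \<not> Q dvd coeff p j"
  proof (rule ccontr)
    assume "\<nexists>j. \<not> Q dvd coeff p j"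
    then have "[:Q:] dvd p" by (simp add: const_poly_dvd_iff)
    then have "Q dvd content p" by (simp add: const_poly_dvd_iff_dvd_content)
    then show False using cont Q by auto
  qed
  \<comment> \<open>Primitivity of \<open>p\<close> provides a coefficient not divisible by
    \<open>Q\<close>; take the lowest one.\<close>
  define j where "j = (LEAST j. \<not> Q dvd coeff p j)"
  have j: "\<not> Q dvd coeff p j" unfolding j_def using \<open>\<exists>j. \<not> Q dvd coeff p j\<close> by (rule LeastI_ex)
  have below: "Q dvd coeff p i" if "i < j" for i using not_less_Least[of i] that unfolding j_def by blast
  have jd: "j < d" using j degp by (metis dvd_0_right le_degree le_less_trans)
  have yd: "y ^ d = of_int Q * (\<Sum>i<d. of_int (- h i) * y ^ i)"
  proof -
    have "y ^ d = (\<Sum>i<d. of_int (- coeff G i) * y ^ i)"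
      using monic_root_power_reduce[OF root monic] deg by simp
    also have "\<dots> = of_int Q * (\<Sum>i<d. of_int (- h i) * y ^ i)"
      unfolding sum_distrib_left by (intro sum.cong) (auto simp: dvd)
    finally show ?thesis .
  qed
  have yd_div: "algebraic_int (y ^ e / of_int Q)" if "d \<le> e" for e
  proof -
    have "y ^ e = y ^ (e - d) * y ^ d" using that by (simp flip: power_add)
    then have "y ^ e / of_int Q = y ^ (e - d) * (\<Sum>i<d. of_int (- h i) * y ^ i)"
      using Q0 by (simp add: yd)
    then show ?thesis
      by (simp only:) (intro algebraic_int_mult algebraic_int_sum algebraic_int_power int_y, auto)
  qed
  have "(\<Sum>i<d. of_int (coeff p i) * y ^ i) = 0"
  proof -
    have "(\<Sum>i<d. of_int (coeff p i) * y ^ i) = (\<Sum>i\<le>Polynomial.degree p. of_int (coeff p i) * y ^ i)"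
      by (rule sum.mono_neutral_right) (use degp in \<open>auto intro: coeff_eq_0\<close>)
    then show ?thesis using p0 by (simp add: poly_altdef degree_map_poly coeff_map_poly)
  qed
  \<comment> \<open>After this shift the terms below \<open>j\<close> are divisible by
    \<open>Q\<close> through their coefficients, those above \<open>j\<close> through powers of
    exponent at least \<open>d\<close>. So \<open>Q\<close> divides the term at \<open>j\<close>
    too.\<close>
  then have "(\<Sum>i<d. of_int (coeff p i) * y ^ i) * y ^ (d - 1 - j) = 0" by simp
  then have "(\<Sum>i<d. of_int (coeff p i) * y ^ (i + (d - 1 - j))) = 0"
    by (simp add: sum_distrib_right power_add mult.assoc)
  then have "of_int (coeff p j) * y ^ (d - 1) + (\<Sum>i\<in>{..<d} - {j}. of_int (coeff p i) * y ^ (i + (d - 1 - j))) = 0"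
    using jd by (subst (asm) sum.remove[of _ j]) auto
  then have "of_int (coeff p j) * y ^ (d - 1) / of_int Q =
      (\<Sum>i\<in>{..<d} - {j}. of_int (- 1) * (of_int (coeff p i) * y ^ (i + (d - 1 - j)) / of_int Q))"
    by (simp add: sum_negf add_eq_0_iff2 flip: sum_divide_distrib)
  moreover have "algebraic_int (of_int (coeff p i) * y ^ (i + (d - 1 - j)) / of_int Q)"
    if i: "i \<in> {..<d} - {j}" for i
  proof (cases "i < j")
    case True
    then obtain k where "coeff p i = Q * k" using below by (auto elim: dvdE)
    then have "of_int (coeff p i) * y ^ (i + (d - 1 - j)) / of_int Q = of_int k * y ^ (i + (d - 1 - j))"
      using Q0 by simp
    then show ?thesis by (simp only:) (intro algebraic_int_mult algebraic_int_power int_y, auto)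
  next
    case False
    then have "d \<le> i + (d - 1 - j)" using i jd by auto
    from yd_div[OF this] have "algebraic_int (of_int (coeff p i) * (y ^ (i + (d - 1 - j)) / of_int Q))"
      by (rule algebraic_int_mult[rotated]) auto
    then show ?thesis by simp
  qed
  ultimately have int_\<zeta>: "algebraic_int (of_int (coeff p j) * y ^ (d - 1) / of_int Q)"
    by (simp only:) (intro algebraic_int_sum algebraic_int_mult, auto)
  define \<zeta> where "\<zeta> = of_int (coeff p j) * y ^ (d - 1) / of_int Q"
  define \<kappa> where "\<kappa> = (\<Sum>i<d - 1. of_int (- h (Suc i)) * y ^ i)"
  have "(\<Sum>i<d. of_int (- h i) * y ^ i) = of_int (- h 0) + y * \<kappa>"
  proof -
    have "d = Suc (d - 1)" using deg by simp
    then have "(\<Sum>i<d. of_int (- h i) * y ^ i) = (\<Sum>i<Suc (d - 1). of_int (- h i) * y ^ i)" by simp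
    also have "\<dots> = of_int (- h 0) + y * \<kappa>"
      by (subst sum.lessThan_Suc_shift) (simp add: \<kappa>_def sum_distrib_left ac_simps)
    finally show ?thesis .
  qed
  then have yd': "y ^ d = of_int Q * (of_int (- h 0) + y * \<kappa>)" using yd by simp
  \<comment> \<open>One more factor \<open>y\<close> brings in \<open>y ^ d / Q\<close>, whose
    constant part is \<open>- h 0\<close>; hence \<open>coeff p j * h 0\<close> is a multiple of
    \<open>y\<close>.\<close>
  have "y * \<zeta> = of_int (coeff p j) * y ^ d / of_int Q"
    using deg(2) by (simp add: \<zeta>_def power_eq_if)
  also have "\<dots> = of_int (coeff p j) * (of_int (- h 0) + y * \<kappa>)" using Q0 by (simp add: yd')
  finally have "of_int (coeff p j * h 0) = y * (of_int (coeff p j) * \<kappa> - \<zeta>)"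
    by (simp add: algebra_simps)
  \<comment> \<open>Divisibility by \<open>y\<close> becomes divisibility by \<open>Q\<close> after
    raising to the power \<open>d\<close>.\<close>
  then have "of_int (coeff p j * h 0) ^ d = (y * (of_int (coeff p j) * \<kappa> - \<zeta>)) ^ d" by (rule arg_cong)
  then have "of_int ((coeff p j * h 0) ^ d) / of_int Q =
      (of_int (coeff p j) * \<kappa> + of_int (- 1) * \<zeta>) ^ d * (y ^ d / of_int Q)"
    by (simp add: power_mult_distrib)
  moreover have "algebraic_int \<dots>"
    using int_\<zeta> unfolding \<zeta>_def[symmetric] \<kappa>_def
    by (intro algebraic_int_mult algebraic_int_power algebraic_int_add algebraic_int_sum int_y yd_div) auto
  ultimately have "algebraic_int (of_int ((coeff p j * h 0) ^ d) / of_int Q :: real)" by (simp only:)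
  then obtain k where "of_int ((coeff p j * h 0) ^ d) / of_int Q = (of_int k :: real)"
    using rational_algebraic_int_eq_of_int[of "of_int ((coeff p j * h 0) ^ d) / of_int Q :: real"] by auto
  then have "real_of_int ((coeff p j * h 0) ^ d) = of_int (Q * k)" using Q0 by (simp add: field_simps)
  then have "Q dvd (coeff p j * h 0) ^ d" by (metis dvd_triv_left of_int_eq_iff)
  then have "Q dvd coeff p j * h 0" using Q prime_dvd_power by blast
  then show False using Q j h0 by (simp add: prime_dvd_mult_iff)
qed

section \<open>Fields of degree at least three\<close>

lemma alternating_prod_ge_1:
  fixes x :: real
  assumes x: "x = - (real C + 2 * real i + 1)" and i: "i < n"
  shows "1 \<le> (-1) ^ i * ((x - 1) * (\<Prod>k<n. x + real C + 2 * real k))"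
proof -
  \<comment> \<open>Here \<open>x\<close> is one less than a zero of the product, and consecutive
    zeros are 2 apart. So every factor is an odd integer, negative exactly for the
    \<open>i + 1\<close> indices \<open>k \<le> i\<close>.\<close>
  have f: "x + real C + 2 * real k = (if k \<le> i then - 1 else 1) * \<bar>x + real C + 2 * real k\<bar>"
    and a: "1 \<le> \<bar>x + real C + 2 * real k\<bar>" for k
  proof -
    consider "k \<le> i" "real k \<le> real i" | "\<not> k \<le> i" "real i + 1 \<le> real k" by (cases "k \<le> i") auto
    then show "x + real C + 2 * real k = (if k \<le> i then - 1 else 1) * \<bar>x + real C + 2 * real k\<bar>"
      "1 \<le> \<bar>x + real C + 2 * real k\<bar>"
      unfolding x by (cases; simp)+
  qed
  have "(\<Prod>k<n. x + real C + 2 * real k)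
      = (\<Prod>k<n. (if k \<le> i then - 1 else 1) * \<bar>x + real C + 2 * real k\<bar>)"
    by (rule prod.cong[OF refl f])
  also have "\<dots> = (\<Prod>k<n. if k \<le> i then - 1 else 1) * (\<Prod>k<n. \<bar>x + real C + 2 * real k\<bar>)"
    by (rule prod.distrib)
  also have "(\<Prod>k<n. if k \<le> i then - 1 else (1 :: real)) = (- 1) ^ Suc i"
  proof -
    have "{..<n} \<inter> {k. k \<le> i} = {..i}" using i by auto
    then show ?thesis by (simp add: prod.If_cases)
  qed
  finally have "(-1) ^ i * ((x - 1) * (\<Prod>k<n. x + real C + 2 * real k))
      = ((-1) ^ i * (-1) ^ i) * ((1 - x) * (\<Prod>k<n. \<bar>x + real C + 2 * real k\<bar>))"
    by (simp add: algebra_simps)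
  also have "\<dots> = (1 - x) * (\<Prod>k<n. \<bar>x + real C + 2 * real k\<bar>)" by (simp flip: power_add)
  also have "\<dots> \<ge> 1 * 1"
    using x a by (intro mult_mono prod_ge_1) auto
  finally show ?thesis by simp
qed

text \<open>
  The roots of the polynomial below are close to \<open>1\<close>, to the numbers \<open>-(C + 2 * i)\<close> and to the two
  square roots of \<open>Q\<close>. Its value at \<open>1\<close> is \<open>1\<close>, so \<open>y - 1\<close> is a unit for each root \<open>y\<close>, and \<open>y\<close> and
  \<open>y - 1\<close> have the same sign as no root lies in the interval from \<open>0\<close> to \<open>1\<close>.
\<close>

lemma ex_ramified_root_field_degree_ge_3:
  fixes d M :: nat and B :: real
  assumes "3 \<le> d"
  shows "\<exists>G Y y\<^sub>0 Q U V. ramified_root_field d G Y y\<^sub>0 Q U V M \<and> B < of_int Q"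
proof -
  define n where "n = d - 3"
  have d: "d = n + 3" using assms by (simp add: n_def)
  \<comment> \<open>This shift keeps the zeros of the product below \<open>- M\<close>.\<close>
  define C where "C = M + 1"
  \<comment> \<open>The size of the prime lets the multiple of \<open>Q\<close> dominate
    \<open>x ^ d\<close> at moderate points, and keeps \<open>Q\<close> from dividing any
    \<open>C + 2 * i\<close>.\<close>
  obtain p where p: "prime p" "max (nat \<lceil>B\<rceil>) ((C + 2 * d) ^ d) < p" using bigger_prime by blast
  define Q where "Q = int p"
  have Q: "prime Q" using p by (simp add: Q_def)
  have QB: "B < of_int Q" using p(2) unfolding Q_def by (simp add: ceiling_less_iff) linarith
  have Qbig: "(real C + 2 * real d) ^ d < of_int Q"
  proof -
    have "real ((C + 2 * d) ^ d) < real p" using p(2) by (simp only: of_nat_less_iff)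
    then show ?thesis by (simp add: Q_def)
  qed
  have Qpos: "0 < Q" using p by (simp add: Q_def prime_gt_0_nat)
  define H where "H = [:-1, 1:] * (\<Prod>i<n. [:int C + 2 * int i, 1:])"
  define G where "G = Polynomial.monom 1 d - Polynomial.smult Q H"
  have monic_prod: "lead_coeff (\<Prod>i<n. [:int C + 2 * int i, 1:]) = 1"
    by (subst lead_coeff_prod) auto
  have deg_prod: "Polynomial.degree (\<Prod>i<n. [:int C + 2 * int i, 1:]) = n"
    by (subst degree_prod_eq_sum_degree) auto
  have deg_H: "Polynomial.degree H = n + 1"
    using deg_prod monic_prod unfolding H_def by (subst degree_mult_eq) auto
  have lead_H: "coeff H (n + 1) = 1"
  proof -
    have "lead_coeff H = 1" unfolding H_def by (simp only: lead_coeff_mult monic_prod) simp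
    then show ?thesis using deg_H by simp
  qed
  have coeff_G: "coeff G k = Q * (- coeff H k)" if "k < d" for k using that by (simp add: G_def)
  have coeff_Gd: "coeff G d = 1" using deg_H d by (simp add: G_def coeff_eq_0)
  have deg_G: "Polynomial.degree G = d"
  proof (rule antisym)
    show "Polynomial.degree G \<le> d"
      by (rule degree_le) (use deg_H d in \<open>auto simp: G_def coeff_eq_0\<close>)
    show "d \<le> Polynomial.degree G" using coeff_Gd by (intro le_degree) simp
  qed
  have eval: "poly (map_poly of_int G) x = x ^ d - of_int Q * ((x - 1) * (\<Prod>i<n. x + real C + 2 * real i))"
    for x :: real
    by (simp add: G_def H_def hom_distribs poly_monom poly_prod algebra_simps)
  \<comment> \<open>At \<open>A\<close> and \<open>- A\<close> the leading term dominates: the rest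
    is at most \<open>Q * 2 ^ d * A ^ (n + 1)\<close>, and \<open>Q * 2 ^ d < A\<close>.\<close>
  define A where "A = real C + 2 * real d + of_int Q * 2 ^ d"
  have A: "real C + 2 * real d \<le> A" "of_int Q * 2 ^ d < A" "1 \<le> A"
    using Qpos d by (auto simp: A_def)
  have big: "\<bar>of_int Q * ((x - 1) * (\<Prod>i<n. x + real C + 2 * real i))\<bar> < A ^ d" if x: "\<bar>x\<bar> = A" for x
  proof -
    have "(\<Prod>i<n. \<bar>x + real C + 2 * real i\<bar>) \<le> (\<Prod>i<n. 2 * A)"
      using A x d by (intro prod_mono) auto
    then have "\<bar>(x - 1) * (\<Prod>i<n. x + real C + 2 * real i)\<bar> \<le> (2 * A) * (2 * A) ^ n"
      unfolding abs_mult abs_prod using A x by (intro mult_mono) (auto intro!: prod_nonneg)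
    then have "\<bar>of_int Q * ((x - 1) * (\<Prod>i<n. x + real C + 2 * real i))\<bar> \<le> of_int Q * (2 * A) ^ (n + 1)"
      unfolding abs_mult[of "of_int Q"] using Qpos by (intro mult_mono) auto
    also have "\<dots> = (of_int Q * 2 ^ (n + 1)) * A ^ (n + 1)" by (simp add: power_mult_distrib)
    also have "\<dots> \<le> (of_int Q * 2 ^ d) * A ^ (n + 1)"
      using Qpos A d by (intro mult_right_mono mult_left_mono power_increasing) auto
    also have "\<dots> < A * A ^ (n + 1)" using A by (intro mult_strict_right_mono) auto
    also have "\<dots> \<le> A ^ d" unfolding power_Suc[symmetric] using A d by (intro power_increasing) auto
    finally show ?thesis .
  qed
  \<comment> \<open>Between the extreme points, the values 2 and 1 separate the root near 1 from the
    large positive one, and the others are midpoints between zeros of the product or lie just left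
    of the last.\<close>
  define t where "t k = (if k = 0 then A else if k = 1 then 2 else if k = 2 then 1
      else if k = d then - A else - (real C + 2 * real (k - 3) + 1))" for k
  have "\<exists>Y. card Y = d \<and> (\<forall>y\<in>Y. poly (map_poly of_int G) y = (0 :: real))"
  proof (rule alternating_poly_roots[where t = t])
    fix k assume k: "k < d"
    have "k = 0 \<or> k = 1 \<or> k = 2 \<or> 3 \<le> k \<and> Suc k < d \<or> 3 \<le> k \<and> Suc k = d" using k by linarith
    then show "t (Suc k) < t k"
      using A d by (elim disjE) (auto simp: t_def of_nat_diff)
  next
    fix k assume k: "k \<le> d"
    have pos: "0 < real C + 2 * real d" using d by simp
    consider "k = 0" | "k = 1" | "k = 2" | "k = d" "3 \<le> k" | i where "k = i + 3" "i < n"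
      using k d by (metis add.commute le_Suc_ex le_neq_implies_less nat_add_left_cancel_less not_less_eq_eq numeral_3_eq_3 numeral_2_eq_2 One_nat_def le_0_eq le_Suc_eq)
    then show "0 < (- 1) ^ k * poly (map_poly of_int G) (t k)"
    proof cases
      case 1
      then show ?thesis using big[of A] A by (simp add: t_def eval)
    next
      case 2
      have "1 \<le> (\<Prod>i<n. 2 + real C + 2 * real i)" by (intro prod_ge_1) auto
      then have "of_int Q * 1 \<le> of_int Q * (\<Prod>i<n. 2 + real C + 2 * real i)"
        using Qpos by (intro mult_left_mono) auto
      moreover have "(2 :: real) ^ d \<le> (real C + 2 * real d) ^ d" using d by (intro power_mono) auto
      ultimately show ?thesis using 2 Qbig by (simp add: t_def eval)
    next
      case 3
      moreover have "poly G 1 = 1" by (simp add: G_def H_def poly_monom)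
      ultimately show ?thesis by (simp add: t_def)
    next
      case 4
      have "(- 1) ^ d * (- A) ^ d = A ^ d" by (simp flip: power_mult_distrib)
      moreover have "\<bar>(- 1) ^ d * (of_int Q * ((- A - 1) * (\<Prod>i<n. - A + real C + 2 * real i)))\<bar> < A ^ d"
        using big[of "- A"] A by (simp add: abs_mult)
      ultimately show ?thesis using 4 by (simp add: t_def eval right_diff_distrib)
    next
      case (5 i)
      define x where "x = - (real C + 2 * real i + 1)"
      have tx: "t k = x" using 5 d by (simp add: t_def x_def)
      have sgn: "(- 1) ^ k = - ((- 1) ^ i :: real)" using 5 by (simp add: power_add)
      define W where "W = (x - 1) * (\<Prod>i<n. x + real C + 2 * real i)"
      have "1 \<le> (- 1) ^ i * W"
        unfolding W_def by (rule alternating_prod_ge_1[OF x_def]) (use 5 in auto)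
      then have "of_int Q * 1 \<le> of_int Q * ((- 1) ^ i * W)" using Qpos by (intro mult_left_mono) auto
      moreover have "\<bar>(- 1) ^ k * x ^ d\<bar> \<le> (real C + 2 * real d) ^ d"
        unfolding abs_mult power_abs using 5 d by (simp add: x_def power_mono)
      moreover have "(- 1) ^ k * poly (map_poly of_int G) x = (- 1) ^ k * x ^ d + of_int Q * ((- 1) ^ i * W)"
        unfolding eval W_def[symmetric] sgn by (simp add: algebra_simps)
      ultimately show ?thesis unfolding tx using Qbig by linarith
    qed
  qed
  then obtain Y where Y: "card Y = d" "\<And>y. y \<in> Y \<Longrightarrow> poly (map_poly of_int G) y = (0 :: real)" by blast
  obtain y\<^sub>0 where y\<^sub>0: "y\<^sub>0 \<in> Y" using Y(1) d by (metis add_is_0 card.empty ex_in_conv numeral_eq_Suc nat.distinct(1))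
  have gap: "1 < y \<or> y < - real M" if y: "y \<in> Y" for y
  proof (rule ccontr)
    assume "\<not> (1 < y \<or> y < - real M)"
    then have y1: "y \<le> 1" "- real M \<le> y" by auto
    \<comment> \<open>For a root in the forbidden interval the product is at least 1, so
      \<open>y ^ d + Q * (1 - y) \<le> 0\<close>. This fails for \<open>0 \<le> y\<close>, and for
      negative \<open>y\<close> because \<open>Q\<close> exceeds the absolute value of
      \<open>y ^ d\<close>.\<close>
    have "1 \<le> (\<Prod>i<n. y + real C + 2 * real i)" using y1 by (intro prod_ge_1) (auto simp: C_def)
    then have "(1 - y) * 1 \<le> (1 - y) * (\<Prod>i<n. y + real C + 2 * real i)"
      using y1 by (intro mult_left_mono) auto
    then have "of_int Q * (1 - y) \<le> of_int Q * ((1 - y) * (\<Prod>i<n. y + real C + 2 * real i))"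
      using Qpos by (intro mult_left_mono) auto
    then have le: "y ^ d + of_int Q * (1 - y) \<le> 0"
      using Y(2)[OF y] by (simp add: eval algebra_simps)
    show False
    proof (cases "0 \<le> y")
      case True
      then have "0 \<le> y ^ d" "0 \<le> of_int Q * (1 - y)" using y1 Qpos by auto
      then have "y ^ d = 0" "of_int Q * (1 - y) = 0" using le by linarith+
      then show False using d Qpos by auto
    next
      case False
      have "\<bar>y ^ d\<bar> \<le> (real C + 2 * real d) ^ d"
        unfolding power_abs using False y1 by (intro power_mono) (auto simp: C_def)
      moreover have "of_int Q * 1 \<le> of_int Q * (1 - y)" using False Qpos by (intro mult_left_mono) auto
      ultimately show False using le Qbig by linarith
    qed
  qed
  \<comment> \<open>Dividing \<open>G - 1\<close> by \<open>[:-1, 1:]\<close> gives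
    \<open>W\<close>; at a root this reads \<open>(y - 1) * W(y) = -1\<close>, so \<open>- W\<close>
    yields the inverse unit.\<close>
  have "poly (G - 1) 1 = 0" by (simp add: G_def H_def poly_monom)
  then obtain W where W: "G - 1 = [:-1, 1:] * W" using poly_eq_0_iff_dvd[of "G - 1" 1] by (auto elim: dvdE)
  have unit: "poly (map_poly of_int [:-1, 1:]) y * poly (map_poly of_int (- W)) y = 1" if y: "y \<in> Y" for y
  proof -
    have "G = 1 + [:-1, 1:] * W" using W by (simp add: algebra_simps)
    moreover have "poly (map_poly of_int (1 + [:-1, 1:] * W)) y = 1 + (y - 1) * poly (map_poly of_int W) y"
      by (simp add: hom_distribs algebra_simps)
    ultimately have "poly (map_poly of_int G) y = 1 + (y - 1) * poly (map_poly of_int W) y" by (simp only:)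
    then show ?thesis using Y(2)[OF y] by (simp add: hom_distribs algebra_simps)
  qed
  have h0: "\<not> Q dvd - coeff H 0"
  proof
    assume "Q dvd - coeff H 0"
    moreover have "coeff H 0 = - (\<Prod>i<n. int C + 2 * int i)"
      by (simp add: H_def coeff_mult flip: poly_0_coeff_0) (simp add: poly_prod)
    ultimately have "Q dvd (\<Prod>i<n. int C + 2 * int i)" by simp
    then obtain i where i: "i < n" "Q dvd int C + 2 * int i"
      using Q by (auto simp: prime_dvd_prod_iff)
    then have "Q \<le> int C + 2 * int i" by (intro zdvd_imp_le) (auto simp: C_def)
    then have "of_int Q \<le> real C + 2 * real i" by linarith
    also have "\<dots> \<le> (real C + 2 * real d) ^ 1" using i d by simp
    also have "\<dots> \<le> (real C + 2 * real d) ^ d" using d by (intro power_increasing) auto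
    finally show False using Qbig by simp
  qed
  have "ramified_root_field d G Y y\<^sub>0 Q [:-1, 1:] (- W) M"
  proof
    show "0 < d" "2 \<le> d" using d by auto
    show "Polynomial.degree G = d" "lead_coeff G = 1" using deg_G coeff_Gd by auto
    show "card Y = d" "y\<^sub>0 \<in> Y" "0 < Q" by fact+
    show "poly (map_poly of_int G) y = 0" if "y \<in> Y" for y using Y(2)[OF that] .
    show "P = 0" if "y \<in> Y" "Polynomial.degree P < d" "rpoly P y = 0" for y P
      using eisenstein_root[OF deg_G _ _ Q coeff_G h0 Y(2)[OF that(1)] that(2,3)] deg_G coeff_Gd d by simp
    show "coeff G (d - 1) = 0" using coeff_G[of "d - 1"] deg_H d by (simp add: coeff_eq_0)
    show "coeff G (d - 2) = - Q" using coeff_G[of "d - 2"] lead_H d by simp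
    show "Q dvd coeff G k" if "k < d" for k using coeff_G[OF that] by simp
    show "Q dvd t" if "Q dvd t ^ d" for t using Q that prime_dvd_power by blast
    show "poly (map_poly of_int [:-1, 1:]) y * poly (map_poly of_int (- W)) y = 1" if "y \<in> Y" for y
      using unit[OF that] .
    show "0 < y * poly (map_poly of_int [:-1, 1:]) y" "0 < y \<or> y < - real M" if "y \<in> Y" for y
      using gap[OF that] by (auto intro: mult_pos_pos mult_neg_neg)
  qed
  then show ?thesis using QB by blast
qed

section \<open>Real quadratic fields\<close>

lemma squarefree_dvd_power2_imp_dvd:
  fixes D t :: int
  assumes "squarefree D" "D dvd t\<^sup>2"
  shows "D dvd t"
proof (cases "t = 0")
  case False
  \<comment> \<open>With \<open>D = g * e\<close> and \<open>t = g * f\<close>, coprimality of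
    \<open>e\<close> and \<open>f\<close> forces \<open>e\<close> to divide \<open>g\<close>. Then
    \<open>e^2\<close> divides \<open>D\<close>, so \<open>e\<close> is a unit.\<close>
  define g where "g = gcd D t"
  have g: "g \<noteq> 0" using False by (simp add: g_def)
  obtain e f where e: "D = g * e" and f: "t = g * f"
    unfolding g_def using gcd_dvd1 gcd_dvd2 by (metis dvdE)
  have "gcd (g * e) (g * f) = g" using g_def e f by simp
  then have "coprime e f"
    using g by (metis abs_gcd_int coprime_iff_gcd_eq_1 gcd_mult_distrib_int mult_cancel_left2 gcd_0_int abs_mult)
  have "g * e dvd g * (g * f\<^sup>2)" using assms(2) unfolding e f by (simp add: power2_eq_square ac_simps)
  then have "e dvd g * f\<^sup>2" using g by simp
  then have "e dvd g" using \<open>coprime e f\<close> by (metis coprime_dvd_mult_left_iff coprime_power_right_iff)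
  then have "e\<^sup>2 dvd D" unfolding e power2_eq_square by simp
  then have "is_unit e" using assms(1) squarefreeD by blast
  then have "D dvd g" unfolding e by (simp add: mult_unit_dvd_iff)
  then show ?thesis using f by (metis dvd_mult2)
qed simp

text \<open>If a prime above \<open>N\<close> divides \<open>n^2 + 1\<close> exactly once, it
  divides the squarefree part, which is therefore large.\<close>

lemma ex_squarefree_negative_pell:
  fixes N :: nat
  shows "\<exists>D n s :: int. squarefree D \<and> int N < D \<and> n\<^sup>2 + 1 = s\<^sup>2 * D"
proof -
  \<comment> \<open>Primes up to \<open>N + 2\<close> divide the factorial, so none of them divides
    \<open>a^2 + 1\<close>.\<close>
  define a where "a = int (fact (N + 2))"
  have "0 < a" unfolding a_def by (simp only: of_nat_0_less_iff fact_gt_zero)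
  then have "nat (a\<^sup>2 + 1) \<noteq> 1" by (simp add: nat_eq_iff)
  from prime_factor_nat[OF this] obtain q where q: "prime q" "q dvd nat (a\<^sup>2 + 1)" by blast
  define p where "p = int q"
  have p: "prime p" "p dvd a\<^sup>2 + 1"
    using q by (auto simp: p_def int_dvd_int_iff[symmetric])
  have pa: "\<not> p dvd a"
  proof
    assume "p dvd a"
    then have "p dvd a\<^sup>2" by (simp add: power2_eq_square)
    then have "p dvd 1" using p(2) by (metis dvd_add_right_iff)
    then show False using p(1) by auto
  qed
  have big: "N + 2 < q"
  proof (rule ccontr)
    assume "\<not> N + 2 < q"
    then have "q \<le> N + 2" by simp
    then have "q dvd fact (N + 2)" using q(1) prime_dvd_fact_iff by blast
    then show False using pa unfolding a_def p_def by (metis int_dvd_int_iff)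
  qed
  have "\<exists>n. p dvd n\<^sup>2 + 1 \<and> \<not> p\<^sup>2 dvd n\<^sup>2 + 1"
  proof (cases "p\<^sup>2 dvd a\<^sup>2 + 1")
    case True
    \<comment> \<open>If \<open>p^2\<close> divides \<open>a^2 + 1\<close>, replace \<open>a\<close>
      by \<open>a + p\<close>: the change \<open>p * (2 * a + p)\<close> is divisible by
      \<open>p\<close> only once, since \<open>p\<close> divides neither 2 nor
      \<open>a\<close>.\<close>
    have eq: "(a + p)\<^sup>2 + 1 = (a\<^sup>2 + 1) + p * (2 * a + p)" by (simp add: power2_eq_square algebra_simps)
    have "\<not> p\<^sup>2 dvd p * (2 * a + p)"
    proof
      assume "p\<^sup>2 dvd p * (2 * a + p)"
      then have "p dvd 2 * a + p" using p(1) by (auto simp: power2_eq_square)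
      then have "p dvd 2 * a" by (simp add: dvd_add_left_iff)
      then have "p dvd 2" using pa p(1) by (simp add: prime_dvd_mult_iff)
      then have "p \<le> 2" by (rule zdvd_imp_le) simp
      then show False using big by (simp add: p_def)
    qed
    then have "\<not> p\<^sup>2 dvd (a + p)\<^sup>2 + 1" unfolding eq using True by (metis dvd_add_right_iff)
    moreover have "p dvd (a + p)\<^sup>2 + 1"
      unfolding eq by (rule dvd_add[OF p(2) dvd_triv_left])
    ultimately show ?thesis by blast
  qed (use p(2) in blast)
  then obtain n where n: "p dvd n\<^sup>2 + 1" "\<not> p\<^sup>2 dvd n\<^sup>2 + 1" by blast
  define E where "E = n\<^sup>2 + 1"
  have E0: "E > 0" unfolding E_def by (simp add: add_nonneg_pos)
  define D where "D = squarefree_part E"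
  define s where "s = square_part E"
  have Es: "E = s\<^sup>2 * D" using squarefree_decompose[of E] by (simp add: D_def s_def mult.commute)
  have sf: "squarefree D" by (simp add: D_def)
  have "0 < D" using E0 Es by (metis zero_less_mult_pos zero_less_power2 mult_zero_left power_zero_numeral less_irrefl)
  have "p dvd D"
  proof (rule ccontr)
    assume "\<not> p dvd D"
    then have "p dvd s" using n(1) p(1) unfolding E_def[symmetric] Es
      by (simp add: prime_dvd_mult_iff prime_dvd_power_iff)
    then have "p\<^sup>2 dvd s\<^sup>2" by simp
    then show False using n(2) unfolding E_def[symmetric] Es by simp
  qed
  then have "p \<le> D" using \<open>0 < D\<close> by (rule zdvd_imp_le)
  then have "int N < D" using big by (simp add: p_def)
  then show ?thesis using sf Es E_def by auto
qed

text \<open>The negative Pell equation makes \<open>n + s * y\<close> a unit with inverse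
  \<open>- n + s * y\<close>. It is negative at the conjugate \<open>- y\<close> because
  \<open>n < s * y\<close>.\<close>

lemma ex_ramified_root_field_degree_2:
  fixes M :: nat and B :: real
  shows "\<exists>G Y y\<^sub>0 Q U V. ramified_root_field 2 G Y y\<^sub>0 Q U V M \<and> B < of_int Q"
proof -
  \<comment> \<open>The summand with \<open>M\<close> makes the square root of \<open>D\<close>
    exceed \<open>M\<close>, as \<open>gap_Y\<close> demands.\<close>
  obtain D n' s' :: int where D: "squarefree D" "int (nat \<lceil>B\<rceil> + M\<^sup>2 + 1) < D" "n'\<^sup>2 + 1 = s'\<^sup>2 * D"
    using ex_squarefree_negative_pell by blast
  define n where "n = \<bar>n'\<bar>"
  define s where "s = \<bar>s'\<bar>"
  have ns: "n\<^sup>2 + 1 = s\<^sup>2 * D" "0 \<le> n" using D(3) by (auto simp: n_def s_def)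
  have "s \<noteq> 0"
  proof
    assume "s = 0"
    then show False using ns(1) zero_le_power2[of n] by simp
  qed
  then have s0: "0 < s" by (simp add: s_def)
  have DB: "B < of_int D" using D(2) by linarith
  have DM: "(real M)\<^sup>2 < of_int D" "1 < D"
  proof -
    have "int (M\<^sup>2) < D" using D(2) by linarith
    then have "real_of_int (int (M\<^sup>2)) < of_int D" by (simp only: of_int_less_iff)
    then show "(real M)\<^sup>2 < of_int D" by simp
    show "1 < D" using D(2) by linarith
  qed
  define y where "y = sqrt (of_int D)"
  have y: "y\<^sup>2 = of_int D" "0 < y" "real M < y"
    using DM by (auto simp: y_def intro: real_less_rsqrt)
  define G where "G = [:- D, 0, 1:]"
  define Y where "Y = {y, - y}"
  have Y2: "z\<^sup>2 = of_int D" if "z \<in> Y" for z using that y by (auto simp: Y_def)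
  have ns_real: "(of_int n)\<^sup>2 + 1 = (of_int s)\<^sup>2 * (of_int D :: real)"
    using arg_cong[OF ns(1), of real_of_int] by simp
  have less: "of_int n < of_int s * y"
  proof (rule power2_less_imp_less)
    show "(of_int n)\<^sup>2 < (of_int s * y)\<^sup>2" using ns_real by (simp add: power_mult_distrib y(1))
  qed (use s0 y in auto)
  \<comment> \<open>A linear relation would make the root rational, hence an integer, so the
    squarefree \<open>D > 1\<close> would be a square.\<close>
  have irr: "P = 0" if z: "z \<in> Y" and P: "Polynomial.degree P < 2" "rpoly P z = 0" for z P
  proof -
    define a b where "a = coeff P 0" and "b = coeff P 1"
    have ab: "P = [:a, b:]"
      by (rule poly_eqI) (use P(1) in \<open>auto simp: a_def b_def coeff_pCons coeff_eq_0 split: nat.split\<close>)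
    have "b = 0"
    proof (rule ccontr)
      assume "b \<noteq> 0"
      then have "z = of_rat (- a / b)" using P(2) ab by (simp add: of_rat_divide of_rat_minus field_simps add_eq_0_iff)
      then have "z \<in> \<rat>" by simp
      moreover have "algebraic_int z"
        unfolding algebraic_int_altdef_ipoly
        by (rule exI[of _ G]) (use Y2[OF z] in \<open>simp add: G_def power2_eq_square\<close>)
      ultimately obtain k where "z = of_int k" using rational_algebraic_int_eq_of_int by blast
      then have "real_of_int (k\<^sup>2) = of_int D" using Y2[OF z] by simp
      then have "k\<^sup>2 = D" by (simp only: of_int_eq_iff)
      then have "is_unit k" using D(1) squarefreeD[of D k] by simp
      then have "k\<^sup>2 = 1" using power2_abs[of k] by simp
      then show False using \<open>k\<^sup>2 = D\<close> DM by simp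
    qed
    then show ?thesis using P(2) ab by simp
  qed
  have eval: "poly (map_poly of_int [:b, c:]) z = of_int b + z * of_int c" for b c :: int and z :: real
    by (simp add: of_int_hom.map_poly_pCons_hom)
  have "ramified_root_field 2 G Y y D [:n, s:] [:- n, s:] M"
  proof
    show "0 < (2 :: nat)" "2 \<le> (2 :: nat)" by auto
    show "Polynomial.degree G = 2" "lead_coeff G = 1" by (auto simp: G_def)
    show "card Y = 2" "y \<in> Y" using y by (auto simp: Y_def)
    show "0 < D" using DM by simp
    show "poly (map_poly of_int G) z = 0" if "z \<in> Y" for z
      using Y2[OF that] by (simp add: G_def power2_eq_square)
    show "P = 0" if "z \<in> Y" "Polynomial.degree P < 2" "rpoly P z = 0" for z P
      using irr that .
    show "coeff G (2 - 1) = 0" "coeff G (2 - 2) = - D" by (auto simp: G_def)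
    show "D dvd coeff G k" if "k < 2" for k
      using that by (auto simp: G_def less_2_cases_iff)
    show "D dvd t" if "D dvd t ^ 2" for t using squarefree_dvd_power2_imp_dvd D(1) that by blast
    show "poly (map_poly of_int [:n, s:]) z * poly (map_poly of_int [:- n, s:]) z = 1" if "z \<in> Y" for z
    proof -
      have "poly (map_poly of_int [:n, s:]) z * poly (map_poly of_int [:- n, s:]) z
          = (of_int s)\<^sup>2 * z\<^sup>2 - (of_int n)\<^sup>2"
        unfolding eval by (simp add: power2_eq_square algebra_simps)
      then show ?thesis using ns_real Y2[OF that] by simp
    qed
    show "0 < z * poly (map_poly of_int [:n, s:]) z" if "z \<in> Y" for z
    proof -
      have "0 < y * (of_int n + y * of_int s)"
        using y ns(2) s0 by (intro mult_pos_pos add_nonneg_pos) auto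
      moreover have "0 < (- y) * (of_int n + (- y) * of_int s)"
        using y less by (intro mult_neg_neg) (auto simp: mult.commute)
      ultimately show ?thesis unfolding eval using that by (auto simp only: Y_def)
    qed
    show "0 < z \<or> z < - real M" if "z \<in> Y" for z using that y by (auto simp: Y_def)
  qed
  then show ?thesis using DB by blast
qed

theorem theorem1p1:
  fixes d m :: nat
  assumes "d > 0" and "m > 0" and "2 dvd d \<or> 3 dvd d"
  shows "\<exists>\<F> :: complex set set. infinite \<F> \<and>
    pairwise (\<lambda>F K. \<not> field_of F \<simeq> field_of K) \<F> \<and>
    (\<forall>F\<in>\<F>. number_field F \<and> totally_real F \<and> field_degree F = d \<and>
      (\<forall>r a. universal_form F r a \<longrightarrow> m \<le> r))"
proof (rule infinite_nonisomorphic_family[OF _ order.refl])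
  fix B :: real
  \<comment> \<open>Divisibility by 2 or 3 excludes \<open>d = 1\<close>, and the two constructions
    cover the remaining degrees.\<close>
  have "d = 2 \<or> 3 \<le> d" using assms(1,3) by (cases "d = 1") auto
  then show "\<exists>G Y y\<^sub>0 Q U V.
      ramified_root_field d G Y y\<^sub>0 Q U V ((4 * (d * m)) ^ (d * m)) \<and> B < of_int Q"
    using ex_ramified_root_field_degree_2 ex_ramified_root_field_degree_ge_3 by blast
qed

end
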